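(* There exists a homeomorphism $T\colon X\to X$ of the Cantor set $X$ which is topologically mixing and completely scrambled.
   Context: Let $(X,d)$ be a compact metric space and $T\colon X\to X$ continuous. A pair $x,y\in X$ is proximal if $\liminf_{n\to\infty} d(T^n(x),T^n(y))=0$, asymptotic if $\limsup_{n\to\infty} d(T^n(x),T^n(y))=0$, and Li-Yorke if it is proximal but not asymptotic. $(X,T)$ is completely scrambled if every pair of distinct points $x,y\in X$ is a Li-Yorke pair. $(X,T)$ is topologically mixing if for any nonempty open sets $U,V\subset X$ there is $N$ such that $T^n(U)\cap V\neq\emptyset$ for all $n\geq N$. The Cantor set is the (unique up to homeomorphism) nonempty compact metric space that is zero-dimensional and has no isolated points. *)

theory Defs
  imports "HOL-Analysis.Analysis" "HOL-Library.Liminf_Limsup"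
begin

definition proximal :: "('a::metric_space \<Rightarrow> 'a) \<Rightarrow> 'a \<Rightarrow> 'a \<Rightarrow> bool" where
  "proximal T x y \<longleftrightarrow> liminf (\<lambda>n. ereal (dist ((T ^^ n) x) ((T ^^ n) y))) = 0"

definition asymptotic :: "('a::metric_space \<Rightarrow> 'a) \<Rightarrow> 'a \<Rightarrow> 'a \<Rightarrow> bool" where
  "asymptotic T x y \<longleftrightarrow> limsup (\<lambda>n. ereal (dist ((T ^^ n) x) ((T ^^ n) y))) = 0"

definition li_yorke_pair :: "('a::metric_space \<Rightarrow> 'a) \<Rightarrow> 'a \<Rightarrow> 'a \<Rightarrow> bool" where
  "li_yorke_pair T x y \<longleftrightarrow> proximal T x y \<and> \<not> asymptotic T x y"

definition completely_scrambled :: "'a::metric_space set \<Rightarrow> ('a \<Rightarrow> 'a) \<Rightarrow> bool" where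
  "completely_scrambled X T \<longleftrightarrow> (\<forall>x\<in>X. \<forall>y\<in>X. x \<noteq> y \<longrightarrow> li_yorke_pair T x y)"

definition topologically_mixing :: "'a::metric_space set \<Rightarrow> ('a \<Rightarrow> 'a) \<Rightarrow> bool" where
  "topologically_mixing X T \<longleftrightarrow>
     (\<forall>U V. openin (top_of_set X) U \<and> openin (top_of_set X) V \<and> U \<noteq> {} \<and> V \<noteq> {} \<longrightarrow>
        (\<exists>N. \<forall>n\<ge>N. (T ^^ n) ` U \<inter> V \<noteq> {}))"

definition cantor_set :: "'a::metric_space set \<Rightarrow> bool" where
  "cantor_set X \<longleftrightarrow> X \<noteq> {} \<and> compact X \<and> (top_of_set X) dim_le 0 \<and> (\<forall>x\<in>X. x islimpt X)"

end

theory Submission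
  imports Defs
begin

text \<open>
  Points are sequences of rows \<open>x 0 \<subseteq> x 1 \<subseteq> \<dots>\<close> of sets of integers, and the map is the shift. Row
  \<open>k + 1\<close> refines row \<open>k\<close>: after each \<open>s\<close> in row \<open>k\<close>, as long as the gap up to the next element of
  row \<open>k\<close> permits, marks are added at rapidly growing distances, and the distance between two
  successive marks encodes row \<open>k\<close> on a long window before them. So the tails of rows \<open>k\<close> and \<open>k + 1\<close>
  determine row \<open>k\<close>, which excludes asymptotic pairs; the system itself is not expansive because
  this needs one more row each time. The rows stay sparse, so any two points have long common
  empty stretches, which makes every pair proximal to the fixed point with empty rows. Mixing holds
  because the refinement is local: towers over finite seeds \<open>S\<close> are dense, and the tower over
  \<open>S \<union> (S' + n)\<close> looks like the tower over \<open>S\<close> near \<open>0\<close> and like the tower over \<open>S'\<close> near \<open>n\<close>.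
\<close>

section \<open>Scales and codes\<close>

text \<open>Growth is iterated exponential so that, for \<open>i > 0\<close>,
  \<open>magnitude i\<close> exceeds every code of a window of length \<open>window i\<close>
  together with the length of that window. There is no circularity: \<open>unit_run i\<close> and
  \<open>window i\<close> involve only \<open>magnitude (i - 1)\<close>.\<close>

fun magnitude :: "nat \<Rightarrow> nat" where
  "magnitude 0 = 1"
| "magnitude (Suc i) = 2 ^ ((i + 9) * (4 ^ Suc i * magnitude i))"

declare magnitude.simps(2) [simp del]

definition unit_run :: "nat \<Rightarrow> nat" where
  "unit_run i = 4 ^ i * magnitude (i - 1)"

definition window :: "nat \<Rightarrow> nat" where
  "window i = (i + 2) * unit_run i"

text \<open>The factor \<open>4 ^ (i - k)\<close> is a budget. Each refinement divides the gap of
  scale \<open>i\<close> by 4: the first half of the old gap houses the new marks, and enough stays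
  free for the next row.\<close>

definition gap :: "nat \<Rightarrow> nat \<Rightarrow> int" where
  "gap k i = int (4 ^ (i - k) * magnitude i)"

text \<open>This is the distance searched for a gap of scale \<open>i\<close>. It grows by one
  \<open>unit_run i\<close> per row because the \<open>i\<close>-th mark may lie that far beyond its
  base point.\<close>

definition run :: "nat \<Rightarrow> nat \<Rightarrow> int" where
  "run k i = int ((k + 1) * unit_run i)"

lemma magnitude_pos: "magnitude i > 0"
  by (cases i) (auto simp: magnitude.simps)

lemma unit_run_pos: "unit_run i > 0"
  by (simp add: unit_run_def magnitude_pos)

lemma less_unit_run: "i < unit_run i"
proof -
  have "i < 4 ^ i"
    by (induction i) auto
  then show ?thesis
    unfolding unit_run_def using magnitude_pos[of "i - 1"]
    by (metis (no_types) One_nat_def Suc_leI less_le_trans mult.right_neutral mult_le_mono2)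
qed

lemma magnitude_eq: "0 < i \<Longrightarrow> magnitude i = 2 ^ ((i + 8) * unit_run i)"
  by (cases i) (auto simp: unit_run_def magnitude.simps)

lemma magnitude_large:
  assumes "0 < i"
  shows "2 ^ Suc (window i) + (i + 2) * unit_run i \<le> magnitude i"
proof -
  let ?p = "unit_run i"
  have p: "?p \<ge> 1" using unit_run_pos[of i] by linarith
  have "(i + 2) * ?p \<le> 2 ^ Suc (window i)"
    unfolding window_def by (meson less_exp less_imp_le lessI less_trans)
  then have "2 ^ Suc (window i) + (i + 2) * ?p \<le> 2 ^ Suc (Suc (window i))"
    by simp
  also have "\<dots> \<le> 2 ^ ((i + 8) * ?p)"
  proof (rule power_increasing)
    have "(i + 8) * ?p = window i + 6 * ?p"
      by (simp add: window_def algebra_simps)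
    then show "Suc (Suc (window i)) \<le> (i + 8) * ?p" using p by linarith
  qed simp
  finally show ?thesis using magnitude_eq[OF assms] by simp
qed

lemma less_magnitude: "i < magnitude i"
proof (cases i)
  case (Suc j)
  then have "i < unit_run i" "(i + 2) * unit_run i \<le> magnitude i"
    using less_unit_run magnitude_large[of i] by auto
  then show ?thesis by simp
qed simp

lemma unit_run_Suc: "unit_run (Suc i) = 4 * (4 ^ i * magnitude i)"
  by (simp add: unit_run_def)

lemma unit_run_le_magnitude: "0 < i \<Longrightarrow> unit_run i \<le> magnitude i"
  using magnitude_large[of i] by simp

lemma magnitude_le_unit_run: "magnitude i \<le> unit_run (Suc i)"
  unfolding unit_run_def by simp

lemma magnitude_mono: "i \<le> j \<Longrightarrow> magnitude i \<le> magnitude j"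
proof (rule lift_Suc_mono_le[where f = magnitude])
  fix n show "magnitude n \<le> magnitude (Suc n)"
    using magnitude_le_unit_run[of n] unit_run_le_magnitude[of "Suc n"] by linarith
qed

lemma unit_run_mono: "i \<le> j \<Longrightarrow> unit_run i \<le> unit_run j"
  unfolding unit_run_def by (intro mult_mono power_increasing magnitude_mono) auto

lemma window_mono: "i \<le> j \<Longrightarrow> window i \<le> window j"
  unfolding window_def by (intro mult_mono unit_run_mono) auto

lemma run_mono: "i \<le> j \<Longrightarrow> run k i \<le> run k j"
  unfolding run_def using unit_run_mono by (metis mult_le_mono2 of_nat_mono)

lemma gap_mono: "i \<le> j \<Longrightarrow> gap k i \<le> gap k j"
  unfolding gap_def of_nat_le_iff by (intro mult_mono power_increasing magnitude_mono) auto

lemma gap_Suc_left: "k < i \<Longrightarrow> gap k i = 4 * gap (Suc k) i"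
  by (simp add: gap_def Suc_diff_Suc[symmetric])

lemma magnitude_le_gap: "int (magnitude i) \<le> gap k i"
proof -
  have "1 * magnitude i \<le> 4 ^ (i - k) * magnitude i" by (rule mult_le_mono1) simp
  then show ?thesis unfolding gap_def by linarith
qed

lemma gap_le_unit_run: "gap k i \<le> int (unit_run (Suc i))"
proof -
  have "(4::nat) ^ (i - k) \<le> 4 ^ Suc i" by (rule power_increasing) auto
  then have "4 ^ (i - k) * magnitude i \<le> 4 ^ Suc i * magnitude i" by (rule mult_le_mono1)
  then show ?thesis unfolding gap_def unit_run_def by (simp only: of_nat_le_iff diff_Suc_1)
qed

lemma gap_pos: "gap k i > 0"
  using magnitude_le_gap[of i k] magnitude_pos[of i] by linarith

lemma run_Suc_left: "run (Suc k) i = run k i + int (unit_run i)"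
  by (simp add: run_def algebra_simps)

lemma run_nonneg: "run k i \<ge> 0"
  by (simp add: run_def)

lemma run_le_window: "k \<le> Suc i \<Longrightarrow> run k i \<le> int (window i)"
  unfolding run_def window_def of_nat_le_iff by (intro mult_le_mono1) auto

section \<open>Binary codes of windows to the left of a point\<close>

fun past_code :: "nat \<Rightarrow> int set \<Rightarrow> int \<Rightarrow> nat" where
  "past_code 0 V t = of_bool (t \<in> V)"
| "past_code (Suc l) V t = past_code l V t + of_bool (t - int (Suc l) \<in> V) * 2 ^ Suc l"

lemma past_code_less: "past_code l V t < 2 ^ Suc l"
  by (induction l) (auto simp: of_bool_def)

lemma past_code_cong:
  "(\<And>j. j \<le> l \<Longrightarrow> t - int j \<in> V \<longleftrightarrow> t' - int j \<in> W) \<Longrightarrow> past_code l V t = past_code l W t'"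
proof (induction l)
  case 0
  then show ?case using "0"[of 0] by simp
next
  case (Suc l)
  have "past_code l V t = past_code l W t'" using Suc by simp
  moreover have "t - int (Suc l) \<in> V \<longleftrightarrow> t' - int (Suc l) \<in> W" using Suc.prems by blast
  ultimately show ?case by (simp only: past_code.simps)
qed

lemma past_code_inject:
  "past_code l V t = past_code l W t' \<Longrightarrow> j \<le> l \<Longrightarrow> t - int j \<in> V \<longleftrightarrow> t' - int j \<in> W"
proof (induction l)
  case 0
  then show ?case by (auto simp: of_bool_def split: if_splits)
next
  case (Suc l)
  have *: "past_code l V t < 2 ^ Suc l" "past_code l W t' < 2 ^ Suc l"
    by (rule past_code_less)+
  \<comment> \<open>The lower bits sum to less than \<open>2 ^ Suc l\<close>, so equal codes have
    equal top bits.\<close>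
  have eq: "(t - int (Suc l) \<in> V) = (t' - int (Suc l) \<in> W)"
    using Suc.prems(1) * by (auto simp: of_bool_def simp del: power_Suc split: if_splits)
  then have "past_code l V t = past_code l W t'"
    using Suc.prems(1) by simp
  then show ?case using Suc.IH Suc.prems(2) eq by (metis le_Suc_eq)
qed

section \<open>Refining a row\<close>

text \<open>For \<open>i > k\<close> the distance between the \<open>i\<close>-th and the next mark after \<open>s\<close> encodes the part of
  \<open>V\<close> in the window of length \<open>window i\<close> before the \<open>i\<close>-th mark; all marks up to the
  \<open>(k + 1)\<close>-st coincide with \<open>s\<close>.\<close>

fun mark :: "nat \<Rightarrow> int set \<Rightarrow> int \<Rightarrow> nat \<Rightarrow> int" where
  "mark k V s 0 = s"
| "mark k V s (Suc i) = (if i \<le> k then s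
     else mark k V s i + gap (Suc k) i + int (past_code (window i) V (mark k V s i)))"

declare mark.simps(2) [simp del]

lemma mark_Suc: "k < i \<Longrightarrow>
    mark k V s (Suc i) = mark k V s i + gap (Suc k) i + int (past_code (window i) V (mark k V s i))"
  by (simp add: mark.simps)

lemma mark_eq: "i \<le> Suc k \<Longrightarrow> mark k V s i = s"
  by (cases i) (auto simp: mark.simps)

definition vacant :: "int set \<Rightarrow> int \<Rightarrow> int \<Rightarrow> bool" where
  "vacant V s d \<longleftrightarrow> V \<inter> {s<..<s + d} = {}"

text \<open>Indices \<open>j \<le> Suc k\<close> carry no condition and give \<open>s\<close>
  itself, so the old row survives. The \<open>j\<close>-th mark asks only for gaps of scales below
  \<open>j\<close>.\<close>

definition refine :: "nat \<Rightarrow> int set \<Rightarrow> int set" where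
  "refine k V = {mark k V s j | s j. s \<in> V \<and> (\<forall>i. k < i \<and> i < j \<longrightarrow> vacant V s (gap k i))}"

primrec tower :: "int set \<Rightarrow> nat \<Rightarrow> int set" where
  "tower V 0 = V"
| "tower V (Suc k) = refine k (tower V k)"

lemma vacant_mono: "vacant V s d \<Longrightarrow> d' \<le> d \<Longrightarrow> vacant V s d'"
  by (auto simp: vacant_def)

lemma vacant_gap_mono: "vacant V s (gap k i) \<Longrightarrow> j \<le> i \<Longrightarrow> vacant V s (gap k j)"
  using vacant_mono gap_mono by blast

lemma vacantD: "vacant V s d \<Longrightarrow> t \<in> V \<Longrightarrow> s < t \<Longrightarrow> s + d \<le> t"
  unfolding vacant_def by (rule ccontr) auto

lemma subset_refine: "V \<subseteq> refine k V"
proof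
  fix s assume "s \<in> V"
  then have "s = mark k V s 0 \<and> s \<in> V \<and> (\<forall>i. k < i \<and> i < 0 \<longrightarrow> vacant V s (gap k i))"
    by simp
  then show "s \<in> refine k V" unfolding refine_def by blast
qed

lemma mark_step: "k < i \<Longrightarrow> mark k V s i + gap (Suc k) i \<le> mark k V s (Suc i)"
  by (simp add: mark_Suc)

lemma mark_mono: "i \<le> j \<Longrightarrow> mark k V s i \<le> mark k V s j"
proof (rule lift_Suc_mono_le[where f = "mark k V s"])
  fix n show "mark k V s n \<le> mark k V s (Suc n)"
    using mark_eq[of n k V s] mark_eq[of "Suc n" k V s] mark_step[of k n V s] gap_pos[of "Suc k" n]
    by (cases "n \<le> k") auto
qed

lemma mark_ge: "s \<le> mark k V s i"
  using mark_mono[of 0 i k V s] by simp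

text \<open>The two bounds feed each other. If the \<open>i\<close>-th mark is within
  \<open>unit_run i\<close> of \<open>s\<close>, this offset plus the code is at most
  \<open>magnitude i\<close>, hence at most one new gap; so the next mark is within two new gaps,
  which is half an old one. That in turn is below \<open>unit_run (Suc i)\<close>.\<close>

lemma mark_bounds:
  shows mark_le: "0 < i \<Longrightarrow> mark k V s i \<le> s + int (unit_run i)"
    and mark_Suc_le: "k < i \<Longrightarrow> 2 * mark k V s (Suc i) \<le> 2 * s + gap k i"
proof -
  have step: "2 * mark k V s (Suc i) \<le> 2 * s + gap k i"
    if "k < i" and IH: "mark k V s i \<le> s + int (unit_run i)" for i
  proof -
    have "past_code (window i) V (mark k V s i) + unit_run i \<le> magnitude i"
      using magnitude_large[of i] past_code_less[of "window i" V "mark k V s i"] \<open>k < i\<close> by simp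
    then have "int (past_code (window i) V (mark k V s i)) + int (unit_run i) \<le> int (magnitude i)"
      by linarith
    then have "mark k V s (Suc i) \<le> s + int (magnitude i) + gap (Suc k) i"
      using IH mark_Suc[OF \<open>k < i\<close>, of V s] by linarith
    also have "\<dots> \<le> s + 2 * gap (Suc k) i" using magnitude_le_gap[of i "Suc k"] by simp
    finally show ?thesis using gap_Suc_left[OF \<open>k < i\<close>] by simp
  qed
  have main: "0 < i \<longrightarrow> mark k V s i \<le> s + int (unit_run i)" for i
  proof (induction i)
    case (Suc i)
    show ?case
    proof (cases "i \<le> k")
      case False
      then have "2 * mark k V s (Suc i) \<le> 2 * s + gap k i"
        using Suc step by simp
      then have "mark k V s (Suc i) \<le> s + int (unit_run (Suc i))"
        using gap_le_unit_run[of k i] mark_ge[of s k V "Suc i"] by linarith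
      then show ?thesis by blast
    qed (simp add: mark_eq)
  qed simp
  then show "0 < i \<Longrightarrow> mark k V s i \<le> s + int (unit_run i)" by simp
  show "k < i \<Longrightarrow> 2 * mark k V s (Suc i) \<le> 2 * s + gap k i" using step main by simp
qed

lemma refineE:
  assumes "u \<in> refine k V"
  obtains s j where "s \<in> V" "u = mark k V s j" "\<And>i. k < i \<Longrightarrow> i < j \<Longrightarrow> vacant V s (gap k i)"
  using assms by (auto simp: refine_def)

lemma mark_in_refine:
  "s \<in> V \<Longrightarrow> vacant V s (gap k i) \<Longrightarrow> j \<le> Suc i \<Longrightarrow> mark k V s j \<in> refine k V"
  unfolding refine_def using vacant_gap_mono by (auto intro!: exI[of _ s] exI[of _ j])

text \<open>The last vacant gap required for the mark ends no later than \<open>s'\<close>, and the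
  marks occupy only its first half. Hence marks of different base points never interleave.\<close>

lemma mark_far:
  assumes "\<And>i. k < i \<Longrightarrow> i < j \<Longrightarrow> vacant V s (gap k i)" "s' \<in> V" "s < s'"
  shows "2 * mark k V s j \<le> s + s'"
proof (cases "j \<le> Suc k")
  case True
  then show ?thesis using mark_eq[of j k V s] assms by simp
next
  case False
  then obtain i where i: "j = Suc i" "k < i" by (cases j) auto
  have "s + gap k i \<le> s'" using assms i vacantD by blast
  then show ?thesis using mark_Suc_le[OF i(2), of V s] i(1) by simp
qed

text \<open>Marks of earlier points end before \<open>s\<close> by \<open>mark_far\<close>. Marks of
  later points start only after the vacant gap of \<open>s\<close>, whose first half already
  contains the mark \<open>Suc i\<close>.\<close>

lemma vacant_between_marks:
  assumes "s \<in> V" "vacant V s (gap k i)" "k < i"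
  shows "refine k V \<inter> {mark k V s i<..<mark k V s (Suc i)} = {}"
proof (rule ccontr)
  assume "\<not> ?thesis"
  then obtain u where u: "u \<in> refine k V" "mark k V s i < u" "u < mark k V s (Suc i)" by auto
  obtain r j where r: "r \<in> V" "u = mark k V r j" "\<And>i. k < i \<Longrightarrow> i < j \<Longrightarrow> vacant V r (gap k i)"
    using refineE[OF u(1)] by metis
  consider "r = s" | "r < s" | "s < r" by linarith
  then show False
  proof cases
    case 1
    then have "i < j" "j < Suc i"
      using u r(2) mark_mono[of j i k V s] mark_mono[of "Suc i" j k V s] by (auto simp: not_le[symmetric])
    then show False by simp
  next
    case 2
    then have "u < s" using mark_far[of k j V r s] r assms(1) by simp
    then show False using u(2) mark_ge[of s k V i] by linarith
  next
    case 3
    then have "s + gap k i \<le> u" using vacantD[OF assms(2) r(1)] mark_ge[of r k V j] r(2) by simp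
    then show False
      using u(3) mark_Suc_le[OF assms(3), of V s] mark_ge[of s k V "Suc i"] by linarith
  qed
qed

text \<open>A new point is the mark \<open>Suc i\<close> of some \<open>r\<close> with
  \<open>k < i\<close>, and its predecessor in the refined row must be the mark \<open>i\<close> of
  the same \<open>r\<close>. So every gap that ends in a new point carries a code.\<close>

lemma refine_gap_code:
  assumes "u \<in> refine k V" "u' \<in> refine k V" "u < u'" "refine k V \<inter> {u<..<u'} = {}" "u' \<notin> V"
  shows "\<exists>i>k. u' - u = gap (Suc k) i + int (past_code (window i) V u)"
proof -
  obtain r j where r: "r \<in> V" "u' = mark k V r j" "\<And>i. k < i \<Longrightarrow> i < j \<Longrightarrow> vacant V r (gap k i)"
    using refineE[OF assms(2)] by metis
  have "\<not> j \<le> Suc k" using assms(5) r(1,2) mark_eq by metis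
  then obtain i where i: "j = Suc i" "k < i" by (cases j) auto
  have v: "vacant V r (gap k i)" using r i by simp
  have "mark k V r i < u'"
    using mark_step[OF i(2), of V r] gap_pos[of "Suc k" i] r(2) i(1) by simp
  moreover have "mark k V r i \<in> refine k V" using mark_in_refine r(1) v by simp
  moreover have "refine k V \<inter> {mark k V r i<..<u'} = {}"
    using vacant_between_marks[OF r(1) v i(2)] r(2) i(1) by simp
  ultimately have "\<not> mark k V r i < u" "\<not> u < mark k V r i"
    using assms(1,3,4) by auto
  then have "mark k V r i = u" by simp
  then show ?thesis using i r(2) mark_Suc[OF i(2), of V r] by auto
qed

text \<open>A code of scale \<open>i\<close> is below \<open>magnitude i\<close>, so the coded
  length stays below \<open>2 * gap k i\<close>. Lengths of different scales therefore have disjoint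
  ranges, and a length reveals its scale.\<close>

lemma gap_code_less:
  assumes "k \<le> i" "0 < i" "i < j"
  shows "gap k i + int (past_code (window i) V t) < gap k j"
proof -
  have "past_code (window i) V t < magnitude i"
    using magnitude_large[OF assms(2)] past_code_less[of "window i" V t] by linarith
  then have "gap k i + int (past_code (window i) V t) < 2 * gap k i"
    using magnitude_le_gap[of i k] by linarith
  also have "\<dots> \<le> gap k (Suc i)"
  proof -
    have "4 ^ (Suc i - k) = 4 * (4::nat) ^ (i - k)" using assms by (simp add: Suc_diff_le)
    moreover have "(4 ^ (i - k)::nat) * magnitude i \<le> 4 ^ (i - k) * magnitude (Suc i)"
      using magnitude_mono[of i "Suc i"] by (intro mult_le_mono2) simp
    ultimately have "2 * (4 ^ (i - k) * magnitude i) \<le> 4 ^ (Suc i - k) * magnitude (Suc i)"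
      by (simp)
    then show ?thesis unfolding gap_def by linarith
  qed
  also have "\<dots> \<le> gap k j" using assms by (intro gap_mono) simp
  finally show ?thesis .
qed

lemma gap_code_inject:
  assumes "k \<le> i" "k \<le> j" "0 < i" "0 < j"
    and "gap k i + int (past_code (window i) V t) = gap k j + int (past_code (window j) W t')"
  shows "i = j \<and> past_code (window i) V t = past_code (window i) W t'"
proof -
  have "i = j"
  proof (rule ccontr)
    assume "i \<noteq> j"
    then consider "i < j" | "j < i" by linarith
    then show False
    proof cases
      case 1
      then show False using gap_code_less[of k i j V t] assms by linarith
    next
      case 2
      then show False using gap_code_less[of k j i W t'] assms by linarith
    qed
  qed
  then show ?thesis using assms(5) by simp
qed

section \<open>Sparse rows and their persistence under refinement\<close>

definition settles :: "nat \<Rightarrow> int set \<Rightarrow> int \<Rightarrow> nat \<Rightarrow> bool" where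
  "settles k V s i \<longleftrightarrow> (\<exists>r\<in>V. s \<le> r \<and> r \<le> s + run k i \<and> vacant V r (gap k i))"

text \<open>This serves two purposes: it provides long vacant stretches, which give proximality, and
  coded gaps arbitrarily far to the right, which exclude asymptotic pairs.\<close>

definition sparse_row :: "nat \<Rightarrow> int set \<Rightarrow> bool" where
  "sparse_row k V \<longleftrightarrow> (\<forall>s\<in>V. \<forall>i>k. settles k V s i \<or> settles k V s (Suc i))"

text \<open>Usually the \<open>i\<close>-th mark of the old witness \<open>q\<close> is the new
  witness, as the gap up to the next mark is free. If \<open>u\<close> is a mark of \<open>q\<close>
  beyond the \<open>i\<close>-th one, \<open>u\<close> itself is the witness.\<close>

lemma settles_refine:
  assumes "Suc k < i" "r \<in> V" "u = mark k V r j" "\<And>i. k < i \<Longrightarrow> i < j \<Longrightarrow> vacant V r (gap k i)"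
    and "settles k V r i"
  shows "settles (Suc k) (refine k V) u i"
proof -
  obtain q where q: "q \<in> V" "r \<le> q" "q \<le> r + run k i" "vacant V q (gap k i)"
    using assms(5) by (auto simp: settles_def)
  have ki: "k < i" using assms(1) by simp
  show ?thesis
  proof (cases "r = q \<and> i < j")
    case False
    have *: "vacant (refine k V) (mark k V q i) (gap (Suc k) i)"
      using vacant_between_marks[OF q(1,4) ki] mark_step[OF ki, of V q]
      unfolding vacant_def by auto
    have "u \<le> mark k V q i"
    proof (cases "r = q")
      case True
      then show ?thesis using False assms(3) mark_mono by auto
    next
      case False
      then have "r < q" using q by simp
      then have "u < q" using mark_far[of k j V r q] assms(3,4) q(1) by simp
      then show ?thesis using mark_ge[of q k V i] by linarith
    qed
    moreover have "mark k V q i \<le> u + run (Suc k) i"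
      using mark_le[of i k V q] ki q(3) mark_ge[of r k V j] assms(3) run_Suc_left[of k i] by simp
    moreover have "mark k V q i \<in> refine k V" using mark_in_refine q by simp
    ultimately show ?thesis using * by (auto simp: settles_def)
  next
    case True
    then obtain j' where j': "j = Suc j'" "i \<le> j'" by (cases j) auto
    have v: "vacant V r (gap k j')" using assms(4) j' ki by simp
    have le: "gap (Suc k) i \<le> gap (Suc k) j'" using j' gap_mono by simp
    have kj: "k < j'" using ki j' by simp
    \<comment> \<open>\<open>u\<close> lies in the first half of a vacant stretch of length
      \<open>4 * gap (Suc k) j'\<close>, so two new gaps remain before the next element of
      \<open>V\<close>.\<close>
    have u: "2 * u \<le> 2 * r + 4 * gap (Suc k) j'"
      using mark_Suc_le[OF kj, of V r] gap_Suc_left[OF kj] assms(3) j'(1) by simp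
    have "vacant (refine k V) u (gap (Suc k) i)"
      unfolding vacant_def
    proof (rule ccontr)
      assume "refine k V \<inter> {u<..<u + gap (Suc k) i} \<noteq> {}"
      then obtain w where w: "w \<in> refine k V" "u < w" "w < u + gap (Suc k) i" by auto
      obtain p l where p: "p \<in> V" "w = mark k V p l" "\<And>i. k < i \<Longrightarrow> i < l \<Longrightarrow> vacant V p (gap k i)"
        using refineE[OF w(1)] by metis
      consider "p = r" | "p < r" | "r < p" by linarith
      then show False
      proof cases
        case 1
        then have "j < l" using w(2) p(2) assms(3) mark_mono[of l j k V r] by (auto simp: not_le[symmetric])
        then have "mark k V r (Suc j) \<le> w" using p(2) 1 mark_mono[of "Suc j" l k V r] by simp
        moreover have "u + gap (Suc k) j \<le> mark k V r (Suc j)" using mark_step[of k j] kj j' assms(3) by simp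
        moreover have "gap (Suc k) i \<le> gap (Suc k) j" using j' gap_mono by simp
        ultimately show False using w(3) by linarith
      next
        case 2
        then have "w < r" using mark_far[of k l V p r] p assms(2) by simp
        then show False using w(2) assms(3) mark_ge[of r k V j] by simp
      next
        case 3
        then have "r + 4 * gap (Suc k) j' \<le> w"
          using vacantD[OF v p(1)] mark_ge[of p k V l] p(2) gap_Suc_left[OF kj] by simp
        then show False using w(3) le u gap_pos[of "Suc k" j'] by linarith
      qed
    qed
    moreover have "u \<in> refine k V" unfolding refine_def using assms by blast
    ultimately show ?thesis using run_nonneg by (auto simp: settles_def)
  qed
qed

lemma sparse_row_refine:
  assumes "sparse_row k V"
  shows "sparse_row (Suc k) (refine k V)"
  unfolding sparse_row_def
proof (intro ballI allI impI)
  fix u i assume u: "u \<in> refine k V" and i: "Suc k < i"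
  obtain r j where r: "r \<in> V" "u = mark k V r j" "\<And>i. k < i \<Longrightarrow> i < j \<Longrightarrow> vacant V r (gap k i)"
    using refineE[OF u] by metis
  have "settles k V r i \<or> settles k V r (Suc i)"
    using assms r(1) i by (simp add: sparse_row_def)
  then show "settles (Suc k) (refine k V) u i \<or> settles (Suc k) (refine k V) u (Suc i)"
    using settles_refine[OF _ r] i less_SucI by blast
qed

lemma sparse_row_tower: "sparse_row 0 V \<Longrightarrow> sparse_row k (tower V k)"
  by (induction k) (auto simp: sparse_row_refine)

text \<open>The pair consists of the marks \<open>i\<close> and \<open>Suc i\<close> of the witness.
  The lower bound on \<open>u\<close> drives it to the right as \<open>i\<close> grows, the upper
  bound makes the coded window reach back to \<open>s\<close>, and the bound on \<open>u'\<close>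
  confines the pair to a finite stretch, so that it can be transferred to limits.\<close>

lemma settles_imp_coded_gap:
  assumes "settles k V s i" "Suc k < i"
  shows "\<exists>u u'. u \<in> refine k V \<and> u' \<in> refine k V \<and> refine k V \<inter> {u<..<u'} = {} \<and> u' \<notin> V \<and>
           u' - u = gap (Suc k) i + int (past_code (window i) V u) \<and>
           s + int (magnitude (i - 1)) \<le> u \<and> u \<le> s + int (window i) \<and> u' \<le> s + run k i + gap k i"
proof -
  obtain r where r: "r \<in> V" "s \<le> r" "r \<le> s + run k i" "vacant V r (gap k i)"
    using assms(1) by (auto simp: settles_def)
  have ki: "k < i" using assms(2) by simp
  let ?u = "mark k V r i" and ?u' = "mark k V r (Suc i)"
  have d: "?u' - ?u = gap (Suc k) i + int (past_code (window i) V ?u)" using mark_Suc[OF ki, of V r] by simp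
  then have "?u < ?u'" using gap_pos[of "Suc k" i] by linarith
  then have "r < ?u'" using mark_ge[of r k V i] by linarith
  then have b: "?u' < r + gap k i" using mark_Suc_le[OF ki, of V r] by linarith
  have "?u' \<notin> V" using r(4) \<open>r < ?u'\<close> b by (auto simp: vacant_def)
  moreover have "s + int (magnitude (i - 1)) \<le> ?u"
  proof -
    obtain j where j: "i = Suc j" "k < j" using assms(2) by (cases i) auto
    then show ?thesis
      using mark_step[OF j(2), of V r] mark_ge[of r k V j] magnitude_le_gap[of j "Suc k"] r(2) by simp
  qed
  moreover have "?u \<le> s + int (window i)"
    using mark_le[of i k V r] r(3) run_Suc_left[of k i] run_le_window[of "Suc k" i] ki by simp
  moreover have "?u \<in> refine k V" "?u' \<in> refine k V" using mark_in_refine r by auto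
  ultimately show ?thesis
    using d b r(3) vacant_between_marks[OF r(1,4) ki] by (intro exI[of _ ?u] exI[of _ ?u']) auto
qed

section \<open>Locality\<close>

definition translate :: "int \<Rightarrow> int set \<Rightarrow> int set" where
  "translate n V = {t. t + n \<in> V}"

lemma in_translate [simp]: "t \<in> translate n V \<longleftrightarrow> t + n \<in> V"
  by (simp add: translate_def)

lemma translate_translate [simp]: "translate m (translate n V) = translate (m + n) V"
  by (auto simp: algebra_simps)

lemma translate_0 [simp]: "translate 0 V = V"
  by auto

lemma mark_translate: "mark k (translate n V) s i = mark k V (s + n) i - n"
proof (induction i)
  case (Suc i)
  show ?case
  proof (cases "i \<le> k")
    case False
    have "past_code (window i) (translate n V) (mark k (translate n V) s i)
        = past_code (window i) V (mark k V (s + n) i)"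
      by (rule past_code_cong) (simp add: Suc.IH algebra_simps)
    then show ?thesis using False Suc.IH by (simp add: mark_Suc)
  qed (simp add: mark_eq)
qed simp

lemma vacant_translate [simp]: "vacant (translate n V) s d \<longleftrightarrow> vacant V (s + n) d"
proof -
  have "t \<in> translate n V \<inter> {s<..<s + d} \<longleftrightarrow> t + n \<in> V \<inter> {s + n<..<s + n + d}" for t
    by auto
  then have "translate n V \<inter> {s<..<s + d} = translate n (V \<inter> {s + n<..<s + n + d})"
    by auto
  moreover have "translate n A = {} \<longleftrightarrow> A = {}" for A
    by (metis all_not_in_conv diff_add_cancel in_translate)
  ultimately show ?thesis by (simp add: vacant_def)
qed

lemma refine_translate: "refine k (translate n V) = translate n (refine k V)"
proof -
  have *: "translate n (refine k V) \<subseteq> refine k (translate n V)" for n V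
  proof
    fix u assume "u \<in> translate n (refine k V)"
    then obtain s j where s: "s \<in> V" "u + n = mark k V s j" "\<And>i. k < i \<Longrightarrow> i < j \<Longrightarrow> vacant V s (gap k i)"
      using refineE[of "u + n" k V] by (metis in_translate)
    have "u = mark k (translate n V) (s - n) j \<and> s - n \<in> translate n V \<and>
      (\<forall>i. k < i \<and> i < j \<longrightarrow> vacant (translate n V) (s - n) (gap k i))"
      using s by (simp add: mark_translate flip: s(2))
    then show "u \<in> refine k (translate n V)" unfolding refine_def by blast
  qed
  have "refine k (translate n V) = translate n (translate (- n) (refine k (translate n V)))"
    by simp
  also have "\<dots> \<subseteq> translate n (refine k V)"
    using *[of "- n" "translate n V"] by (auto simp del: translate_translate) (auto simp: subset_iff)
  finally show ?thesis using * by blast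
qed

lemma tower_translate: "tower (translate n V) k = translate n (tower V k)"
  by (induction k) (auto simp: refine_translate)

text \<open>Points far to the left could send marks anywhere; the point \<open>c\<close> blocks
  them, since a mark from below \<open>- L'\<close> stays before the midpoint towards
  \<open>c\<close>, which is left of \<open>- L\<close>. For the other points only scales up to
  \<open>I\<close> matter, and \<open>L'\<close> covers their gaps and windows.\<close>

lemma refine_local_aux:
  fixes c L L' :: int
  defines "I \<equiv> nat (L + \<bar>c\<bar>)"
  assumes L': "L' \<ge> 2 * L + 2 * \<bar>c\<bar> + 1 + gap k I + int (window I)" and "L \<ge> 0"
    and c: "c \<in> V" and left: "V \<inter> {-L'..<c} = {}" and agree: "\<forall>t\<in>{-L'..L'}. t \<in> V \<longleftrightarrow> t \<in> W"
    and u: "u \<in> refine k V" "u \<in> {-L..L}"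
  shows "u \<in> refine k W \<and> c \<le> u"
proof -
  obtain s j where s: "s \<in> V" "u = mark k V s j" "\<And>i. k < i \<Longrightarrow> i < j \<Longrightarrow> vacant V s (gap k i)"
    using refineE[OF u(1)] by metis
  have gpos: "gap k I > 0" by (rule gap_pos)
  have "\<not> s < - L'"
  proof
    assume "s < - L'"
    moreover have "s < c" using \<open>s < - L'\<close> L' gpos \<open>L \<ge> 0\<close> by linarith
    ultimately have "2 * u < c - L'" using mark_far[of k j V s c] s c by simp
    then show False using u(2) L' gpos by auto
  qed
  moreover have "s \<notin> {-L'..<c}" using left s(1) by blast
  ultimately have cs: "c \<le> s" by simp
  have su: "s \<le> u" using s(2) mark_ge by simp
  \<comment> \<open>Passing the \<open>i\<close>-th mark costs at least
    \<open>gap (Suc k) i > i\<close>, while \<open>u - c\<close> is at most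
    \<open>L + \<bar>c\<bar>\<close>.\<close>
  have I: "i \<le> I" if "k < i" "i < j" for i
  proof -
    have "mark k V s i + gap (Suc k) i \<le> u"
      using mark_step[OF that(1), of V s] mark_mono[of "Suc i" j k V s] s(2) that by linarith
    then have "gap (Suc k) i \<le> L + \<bar>c\<bar>" using mark_ge[of s k V i] cs u(2) by auto
    then have "int i \<le> L + \<bar>c\<bar>"
      using magnitude_le_gap[of i "Suc k"] less_magnitude[of i] by linarith
    then show ?thesis by (simp add: I_def)
  qed
  have vac: "vacant W s (gap k i)" if "k < i" "i < j" for i
    unfolding vacant_def
  proof (rule ccontr)
    assume "W \<inter> {s<..<s + gap k i} \<noteq> {}"
    then obtain t where t: "t \<in> W" "s < t" "t < s + gap k i" by auto
    have "t \<in> {-L'..L'}"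
      using t gap_mono[OF I[OF that], of k] cs su u(2) L' by auto
    then have "t \<in> V" using agree t by blast
    then show False using s(3)[OF that] t by (auto simp: vacant_def)
  qed
  have marks: "i \<le> j \<Longrightarrow> mark k W s i = mark k V s i" for i
  proof (induction i)
    case (Suc i)
    show ?case
    proof (cases "i \<le> k")
      case False
      have IH: "mark k W s i = mark k V s i" using Suc by simp
      have "past_code (window i) W (mark k V s i) = past_code (window i) V (mark k V s i)"
      proof (rule past_code_cong)
        fix l assume l: "l \<le> window i"
        have "int l \<le> int (window I)" using l window_mono[of i I] I False Suc.prems by simp
        moreover have "c \<le> mark k V s i" "mark k V s i \<le> L"
          using cs mark_ge[of s k V i] mark_mono[of i j k V s] Suc.prems s(2) u(2) by auto
        ultimately have "mark k V s i - int l \<in> {-L'..L'}" using L' gpos \<open>L \<ge> 0\<close> by auto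
        then show "mark k V s i - int l \<in> W \<longleftrightarrow> mark k V s i - int l \<in> V" using agree by blast
      qed
      then show ?thesis using False IH by (simp add: mark_Suc)
    qed (simp add: mark_eq)
  qed simp
  have "s \<in> {-L'..L'}" using cs su u(2) L' gpos by auto
  then have "s \<in> W" using agree s(1) by blast
  moreover have "u = mark k W s j" using marks s(2) by simp
  ultimately have "u \<in> refine k W" unfolding refine_def using vac by blast
  then show ?thesis using cs su by simp
qed

text \<open>Besides agreement it records the blocking point \<open>c\<close>, with nothing of
  \<open>V\<close> between \<open>- L\<close> and \<open>c\<close>. Refinement keeps this point
  first, so the relation can be carried from row to row.\<close>

definition alike :: "int \<Rightarrow> int \<Rightarrow> int set \<Rightarrow> int set \<Rightarrow> bool" where
  "alike c L V W \<longleftrightarrow> c \<in> V \<and> V \<inter> {-L..<c} = {} \<and> (\<forall>t\<in>{-L..L}. t \<in> V \<longleftrightarrow> t \<in> W)"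

lemma refine_local:
  assumes "L \<ge> 0"
  shows "\<exists>L'\<ge>L. \<forall>V W. alike c L' V W \<longrightarrow> alike c L (refine k V) (refine k W)"
proof -
  define I where "I = nat (L + \<bar>c\<bar>)"
  define L' where "L' = 2 * L + 2 * \<bar>c\<bar> + 1 + gap k I + int (window I)"
  have L': "L' \<ge> L" "\<bar>c\<bar> \<le> L'" using assms gap_pos[of k I] by (auto simp: L'_def)
  have "alike c L (refine k V) (refine k W)" if "alike c L' V W" for V W
  proof -
    have V: "c \<in> V" "V \<inter> {-L'..<c} = {}" and agree: "\<forall>t\<in>{-L'..L'}. t \<in> V \<longleftrightarrow> t \<in> W"
      using that by (auto simp: alike_def)
    have c: "c \<in> {-L'..L'}" using L' by auto
    have W: "c \<in> W" "\<forall>t\<in>{-L'..L'}. t \<in> W \<longleftrightarrow> t \<in> V"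
      using V(1) agree c by blast+
    have "{-L'..<c} \<subseteq> {-L'..L'}" using L' by auto
    then have W': "W \<inter> {-L'..<c} = {}" using V(2) agree by blast
    note aux = refine_local_aux[of L c k L', folded I_def]
    have 1: "u \<in> refine k W \<and> c \<le> u" if "u \<in> refine k V" "u \<in> {-L..L}" for u
      using aux[of V W u] V agree that assms by (simp add: L'_def)
    have 2: "u \<in> refine k V" if "u \<in> refine k W" "u \<in> {-L..L}" for u
      using aux[of W V u] W W' that assms by (simp add: L'_def)
    have "refine k V \<inter> {-L..<c} = {}"
    proof (rule ccontr)
      assume "refine k V \<inter> {-L..<c} \<noteq> {}"
      then obtain u where u: "u \<in> refine k V" "-L \<le> u" "u < c" by auto
      \<comment> \<open>Since \<open>c\<close> may exceed \<open>L\<close>, the bound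
        \<open>u < c\<close> is not enough. The base point of \<open>u\<close> would lie left of
        \<open>- L'\<close>, and \<open>mark_far\<close> then keeps \<open>u\<close> left of the
        origin.\<close>
      have "u \<le> L"
      proof (rule ccontr)
        assume "\<not> u \<le> L"
        obtain s j where s: "s \<in> V" "u = mark k V s j" "\<And>i. k < i \<Longrightarrow> i < j \<Longrightarrow> vacant V s (gap k i)"
          using refineE[OF u(1)] by metis
        have "s < c" using s(2) mark_ge[of s k V j] u by simp
        moreover have "s \<notin> {-L'..<c}" using V(2) s(1) by blast
        ultimately have "s < - L'" by simp
        moreover have "2 * u \<le> s + c" using mark_far[of k j V s c] s V(1) \<open>s < c\<close> by simp
        ultimately show False using \<open>\<not> u \<le> L\<close> assms L' by linarith
      qed
      then show False using 1[of u] u by simp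
    qed
    then show ?thesis using 1 2 V(1) subset_refine[of V k] by (auto simp: alike_def)
  qed
  then show ?thesis using L' by blast
qed

lemma alike_mono: "alike c L V W \<Longrightarrow> L' \<le> L \<Longrightarrow> alike c L' V W"
  unfolding alike_def by auto

lemma tower_local:
  assumes "L \<ge> 0"
  shows "\<exists>L'\<ge>L. \<forall>V W. alike c L' V W \<longrightarrow> (\<forall>k\<le>m. alike c L (tower V k) (tower W k))"
  using assms
proof (induction m arbitrary: L)
  case 0
  then show ?case by auto
next
  case (Suc m)
  obtain L1 where L1: "L1 \<ge> L" "\<And>V W. alike c L1 V W \<Longrightarrow> alike c L (refine m V) (refine m W)"
    using refine_local[OF Suc.prems] by blast
  obtain L' where L': "L' \<ge> L1" "\<And>V W k. alike c L' V W \<Longrightarrow> k \<le> m \<Longrightarrow> alike c L1 (tower V k) (tower W k)"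
    using Suc.IH[of L1] L1 Suc.prems by force
  have "alike c L (tower V k) (tower W k)" if "alike c L' V W" "k \<le> Suc m" for V W k
    using that L1 L'(2)[OF that(1)] alike_mono le_Suc_eq by (metis order_refl tower.simps(2))
  then show ?case using L1(1) L'(1) by (meson order_trans)
qed

section \<open>Seeds\<close>

definition seed :: "int set \<Rightarrow> bool" where
  "seed S \<longleftrightarrow> finite S \<and> S \<noteq> {} \<and> sparse_row 0 S"

lemma settles_translate [simp]: "settles k (translate n V) s i \<longleftrightarrow> settles k V (s + n) i"
proof
  assume "settles k (translate n V) s i"
  then obtain r where "r \<in> translate n V" "s \<le> r" "r \<le> s + run k i" "vacant (translate n V) r (gap k i)"
    by (auto simp: settles_def)
  then show "settles k V (s + n) i" by (auto simp: settles_def intro!: bexI[of _ "r + n"])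
next
  assume "settles k V (s + n) i"
  then obtain r where "r \<in> V" "s + n \<le> r" "r \<le> s + n + run k i" "vacant V r (gap k i)"
    by (auto simp: settles_def)
  then show "settles k (translate n V) s i" by (auto simp: settles_def intro!: bexI[of _ "r - n"])
qed

lemma seed_translate: 
  assumes "seed S"
  shows "seed (translate n S)"
proof -
  have eq: "translate n S = (\<lambda>t. t - n) ` S"
    by (auto simp: image_iff intro!: bexI[of _ "_ + n"])
  have "finite (translate n S)" "translate n S \<noteq> {}"
    using assms unfolding eq by (auto simp: seed_def)
  moreover have "sparse_row 0 (translate n S)"
    using assms by (auto simp: seed_def sparse_row_def)
  ultimately show ?thesis by (simp add: seed_def)
qed

lemma seed_singleton: "seed {0}"
  using run_nonneg by (auto simp: seed_def sparse_row_def settles_def vacant_def)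

text \<open>At most one scale separates the two pieces by a distance that is neither short nor long;
  this is why sparseness only asks for one of two consecutive scales.\<close>

lemma seed_glue:
  assumes "seed S" "seed S'"
  shows "\<exists>n0. \<forall>n\<ge>n0. seed (S \<union> translate (- n) S')"
proof -
  have fin: "finite S" "finite S'" and ne: "S \<noteq> {}" "S' \<noteq> {}"
    using assms by (auto simp: seed_def)
  have "finite (abs ` (S \<union> S'))" using fin by simp
  then obtain q0 where "\<forall>y\<in>abs ` (S \<union> S'). y \<le> q0" using finite_nat_set_iff_bounded_le
    by (meson Max_ge)
  then obtain Q where Q: "\<And>s. s \<in> S \<union> S' \<Longrightarrow> \<bar>s\<bar> \<le> int Q"
    by (metis image_eqI int_nat_eq nle_le order_trans zero_le_imp_eq_int)
  \<comment> \<open>The multiple of \<open>Q\<close> separates the pieces and gives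
    \<open>n + 2 * Q \<le> 4 * (n - 2 * Q)\<close>; the gap term forces \<open>i > 2 * Q\<close> at
    the critical scale.\<close>
  define n0 where "n0 = 10 * int Q + 1 + gap 0 (2 * Q + 1)"
  have "seed (S \<union> translate (- n) S')" if n: "n \<ge> n0" for n
  proof -
    let ?V = "S \<union> translate (- n) S'"
    have nQ: "n > 10 * int Q" using n gap_pos[of 0 "2 * Q + 1"] by (simp add: n0_def)
    have S: "\<bar>s\<bar> \<le> int Q" if "s \<in> S" for s using Q that by blast
    have S': "\<bar>t - n\<bar> \<le> int Q" if "t \<in> translate (- n) S'" for t using Q[of "t - n"] that by simp
    have settles_S: "settles 0 ?V s i" if st: "settles 0 S s i" "gap 0 i \<le> n - 2 * int Q" for s i
    proof -
      obtain r where r: "r \<in> S" "s \<le> r" "r \<le> s + run 0 i" "vacant S r (gap 0 i)"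
        using st(1) by (auto simp: settles_def)
      have "r + gap 0 i \<le> t" if "t \<in> translate (- n) S'" for t
        using S[OF r(1)] S'[OF that] \<open>gap 0 i \<le> n - 2 * int Q\<close> by linarith
      then have "vacant ?V r (gap 0 i)" using r(4) by (fastforce simp: vacant_def)
      then show ?thesis using r by (auto simp: settles_def)
    qed
    have "settles 0 ?V s i \<or> settles 0 ?V s (Suc i)" if s: "s \<in> ?V" and i: "0 < i" for s i
    proof (cases "s \<in> S")
      case False
      then have s': "s - n \<in> S'" using s by simp
      have "settles 0 ?V s j" if "settles 0 S' (s - n) j" for j
      proof -
        have "settles 0 (translate (- n) S') s j" using that by simp
        then obtain r where r: "r \<in> translate (- n) S'" "s \<le> r" "r \<le> s + run 0 j"
            "vacant (translate (- n) S') r (gap 0 j)"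
          by (auto simp: settles_def)
        \<comment> \<open>Vacancy looks only to the right, so the left piece cannot disturb
          it.\<close>
        have "t < r" if "t \<in> S" for t using S[OF that] S'[OF r(1)] nQ by linarith
        then have "vacant ?V r (gap 0 j)" using r(4) by (fastforce simp: vacant_def)
        then show ?thesis using r by (auto simp: settles_def)
      qed
      then show ?thesis using assms(2) s' i by (auto simp: seed_def sparse_row_def)
    next
      case True
      consider "gap 0 (Suc i) \<le> n - 2 * int Q" | "gap 0 (Suc i) > n - 2 * int Q" "gap 0 i \<le> n - 2 * int Q"
        | "gap 0 i > n - 2 * int Q" by linarith
      then show ?thesis
      proof cases
        case 1
        then have "gap 0 i \<le> n - 2 * int Q" using gap_mono[of i "Suc i" 0] by simp
        moreover have "settles 0 S s i \<or> settles 0 S s (Suc i)"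
          using assms(1) True i by (auto simp: seed_def sparse_row_def)
        ultimately show ?thesis using settles_S 1 by blast
      next
        case 2
        \<comment> \<open>At the critical scale the gap of scale \<open>i\<close> still ends before
          the right piece, and the run is long enough to reach the last point of
          \<open>S\<close>.\<close>
        have "2 * Q < i"
        proof (rule ccontr)
          assume "\<not> 2 * Q < i"
          then have "gap 0 (Suc i) \<le> gap 0 (2 * Q + 1)" by (intro gap_mono) simp
          then show False using 2 n by (simp add: n0_def)
        qed
        then have "2 * int Q \<le> run 0 i" using less_unit_run[of i] by (simp add: run_def)
        moreover have "Max S \<in> S" "s \<le> Max S" "vacant S (Max S) (gap 0 i)"
          using fin ne True by (auto simp: vacant_def) (meson Max_ge linorder_not_le)
        moreover have "Max S \<le> s + 2 * int Q" using S[OF True] S[OF \<open>Max S \<in> S\<close>] by linarith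
        ultimately have "settles 0 S s i" by (force simp: settles_def)
        then show ?thesis using settles_S 2 by blast
      next
        case 3
        \<comment> \<open>Here \<open>gap 0 i\<close> exceeds \<open>n - 2 * Q\<close>, so the run
          of scale \<open>Suc i\<close>, four times that gap, reaches the last point of the glued
          set, after which everything is vacant.\<close>
        define M where "M = Max S' + n"
        have "Max S' \<in> S'" using fin ne by simp
        then have M: "M \<in> ?V" by (simp add: M_def)
        have top: "t \<le> M" if "t \<in> ?V" for t
        proof (cases "t \<in> S")
          case True
          then show ?thesis using S[OF True] Q[of "Max S'"] \<open>Max S' \<in> S'\<close> nQ by (auto simp: M_def)
        next
          case False
          then have "t - n \<in> S'" using that by simp
          then have "t - n \<le> Max S'" using fin by simp
          then show ?thesis by (simp add: M_def)
        qed
        have "run 0 (Suc i) = 4 * gap 0 i" by (simp add: run_def gap_def unit_run_Suc)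
        then have "M \<le> s + run 0 (Suc i)"
          using 3 nQ S[OF True] Q[of "Max S'"] \<open>Max S' \<in> S'\<close> unfolding M_def by auto
        moreover have "vacant ?V M (gap 0 (Suc i))" using top by (fastforce simp: vacant_def)
        ultimately show ?thesis using M top[OF s] by (auto simp: settles_def)
      qed
    qed
    moreover have "finite ?V" using fin seed_translate[OF assms(2), of "- n"] by (simp add: seed_def)
    ultimately show ?thesis using ne by (auto simp: seed_def sparse_row_def)
  qed
  then show ?thesis by blast
qed

section \<open>The closure of the towers\<close>

definition agree :: "nat \<Rightarrow> (nat \<Rightarrow> int set) \<Rightarrow> (nat \<Rightarrow> int set) \<Rightarrow> bool" where
  "agree m x y \<longleftrightarrow> (\<forall>k\<le>m. \<forall>t\<in>{- int m..int m}. t \<in> x k \<longleftrightarrow> t \<in> y k)"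

text \<open>This is the closure in the product topology, with the relations \<open>agree m\<close>
  as basic neighbourhoods. Towers over seeds are dense in it by construction, so finite-range
  properties of towers pass to all its points.\<close>

definition tower_closure :: "(nat \<Rightarrow> int set) set" where
  "tower_closure = {x. \<forall>m. \<exists>S. seed S \<and> agree m x (tower S)}"

definition shift :: "int \<Rightarrow> (nat \<Rightarrow> int set) \<Rightarrow> nat \<Rightarrow> int set" where
  "shift n x = (\<lambda>k. translate n (x k))"

lemma agree_sym: "agree m x y \<Longrightarrow> agree m y x"
  by (simp add: agree_def)

lemma agree_trans: "agree m x y \<Longrightarrow> agree m y z \<Longrightarrow> agree m x z"
  by (simp add: agree_def)

lemma agree_mono: "agree n x y \<Longrightarrow> m \<le> n \<Longrightarrow> agree m x y"
  by (auto simp: agree_def)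

lemma agreeD: "agree m x y \<Longrightarrow> k \<le> m \<Longrightarrow> \<bar>t\<bar> \<le> int m \<Longrightarrow> t \<in> x k \<longleftrightarrow> t \<in> y k"
  unfolding agree_def by (meson abs_le_D1 abs_le_D2 atLeastAtMost_iff minus_le_iff)

lemma agree_shift:
  assumes "agree (m + nat \<bar>n\<bar>) x y"
  shows "agree m (shift n x) (shift n y)"
  unfolding agree_def shift_def in_translate
proof (intro allI impI ballI)
  fix k t assume "k \<le> m" "t \<in> {- int m..int m}"
  then show "t + n \<in> x k \<longleftrightarrow> t + n \<in> y k" by (intro agreeD[OF assms]) auto
qed

lemma shift_shift [simp]: "shift m (shift n x) = shift (m + n) x"
  by (simp add: shift_def)

lemma shift_0 [simp]: "shift 0 x = x"
  by (simp add: shift_def)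

lemma agree_all_eq:
  assumes "\<And>m. agree m x y"
  shows "x = y"
proof (intro ext set_eqI)
  fix k t
  show "t \<in> x k \<longleftrightarrow> t \<in> y k"
    by (rule agreeD[OF assms[of "k + nat \<bar>t\<bar>"]]) auto
qed

lemma tower_in_closure: "seed S \<Longrightarrow> tower S \<in> tower_closure"
  by (auto simp: tower_closure_def agree_def)

lemma tower_closure_closed:
  assumes "\<And>m. \<exists>y\<in>tower_closure. agree m x y"
  shows "x \<in> tower_closure"
  using assms unfolding tower_closure_def by (blast intro: agree_trans)

lemma shift_tower: "shift n (tower S) = tower (translate n S)"
  by (simp add: shift_def tower_translate fun_eq_iff)

lemma shift_in_closure:
  assumes "x \<in> tower_closure"
  shows "shift n x \<in> tower_closure"
proof (rule tower_closure_closed)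
  fix m
  obtain S where "seed S" "agree (m + nat \<bar>n\<bar>) x (tower S)"
    using assms by (auto simp: tower_closure_def)
  then have "agree m (shift n x) (tower (translate n S))" "tower (translate n S) \<in> tower_closure"
    using agree_shift[of m n x "tower S"]
    by (auto simp: shift_tower intro: tower_in_closure seed_translate)
  then show "\<exists>y\<in>tower_closure. agree m (shift n x) y" by blast
qed

lemma tower_approx:
  assumes "x \<in> tower_closure"
  shows "\<exists>S. seed S \<and> (\<forall>k\<le>K. \<forall>t\<ge>a. t \<le> b \<longrightarrow> (t \<in> x k \<longleftrightarrow> t \<in> tower S k))"
proof -
  define m where "m = K + nat \<bar>a\<bar> + nat \<bar>b\<bar>"
  obtain S where S: "seed S" "agree m x (tower S)"
    using assms by (auto simp: tower_closure_def)
  have "t \<in> x k \<longleftrightarrow> t \<in> tower S k" if "k \<le> K" "a \<le> t" "t \<le> b" for k t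
  proof -
    have "k \<le> m" "\<bar>t\<bar> \<le> int m" using that by (auto simp: m_def)
    then show ?thesis by (rule agreeD[OF S(2)])
  qed
  then show ?thesis using S(1) by blast
qed

lemma closure_subset_Suc:
  assumes "x \<in> tower_closure"
  shows "x k \<subseteq> x (Suc k)"
proof
  fix t assume t: "t \<in> x k"
  obtain S where S: "\<forall>j\<le>Suc k. \<forall>u\<ge>t. u \<le> t \<longrightarrow> (u \<in> x j \<longleftrightarrow> u \<in> tower S j)"
    using tower_approx[OF assms, of "Suc k" t t] by blast
  have "t \<in> tower S k" using S t by simp
  then show "t \<in> x (Suc k)" using S subset_refine[of "tower S k" k] by auto
qed

lemma closure_mono: "x \<in> tower_closure \<Longrightarrow> j \<le> k \<Longrightarrow> x j \<subseteq> x k"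
  by (rule lift_Suc_mono_le[of x], rule closure_subset_Suc)

lemma settles_cong:
  assumes "settles k V s i" "\<And>t. s \<le> t \<Longrightarrow> t \<le> s + run k i + gap k i \<Longrightarrow> t \<in> V \<longleftrightarrow> t \<in> W"
  shows "settles k W s i"
proof -
  obtain r where r: "r \<in> V" "s \<le> r" "r \<le> s + run k i" "vacant V r (gap k i)"
    using assms(1) by (auto simp: settles_def)
  have "r \<in> W" using assms(2)[of r] r gap_pos[of k i] by simp
  moreover have "vacant W r (gap k i)" 
    unfolding vacant_def
  proof (rule ccontr)
    assume "W \<inter> {r<..<r + gap k i} \<noteq> {}"
    then obtain t where t: "t \<in> W" "r < t" "t < r + gap k i" by auto
    then have "t \<in> V" using assms(2)[of t] r by simp
    then show False using r(4) t by (auto simp: vacant_def)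
  qed
  ultimately show ?thesis using r by (auto simp: settles_def)
qed

text \<open>For fixed \<open>s\<close> and \<open>i\<close> both alternatives concern only the
  stretch from \<open>s\<close> to \<open>b\<close>, where some tower over a seed coincides with
  \<open>x\<close>.\<close>

lemma closure_sparse_row:
  assumes "x \<in> tower_closure"
  shows "sparse_row k (x k)"
  unfolding sparse_row_def
proof (intro ballI allI impI)
  fix s i assume s: "s \<in> x k" and i: "k < i"
  define b where "b = s + run k (Suc i) + gap k (Suc i)"
  obtain S where S: "seed S" "\<And>j t. j \<le> k \<Longrightarrow> s \<le> t \<Longrightarrow> t \<le> b \<Longrightarrow> t \<in> x j \<longleftrightarrow> t \<in> tower S j"
    using tower_approx[OF assms, of k s b] by blast
  have b: "s + run k i + gap k i \<le> b" "s \<le> b"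
    using run_mono[of i "Suc i" k] gap_mono[of i "Suc i" k] run_nonneg[of k "Suc i"] gap_pos[of k "Suc i"]
    by (auto simp: b_def)
  have "s \<in> tower S k" using S(2) s b by auto
  then have "settles k (tower S k) s i \<or> settles k (tower S k) s (Suc i)"
    using sparse_row_tower[of S k] S(1) i by (auto simp: seed_def sparse_row_def)
  then show "settles k (x k) s i \<or> settles k (x k) s (Suc i)"
  proof
    assume "settles k (tower S k) s i"
    then have "settles k (x k) s i" by (rule settles_cong) (use S(2) b in auto)
    then show ?thesis ..
  next
    assume "settles k (tower S k) s (Suc i)"
    then have "settles k (x k) s (Suc i)" by (rule settles_cong) (use S(2) b_def in auto)
    then show ?thesis ..
  qed
qed

section \<open>Coded gaps in the closure and the absence of asymptotic pairs\<close>

lemma closure_gap_code: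
  assumes "x \<in> tower_closure" "u \<in> x (Suc k)" "u' \<in> x (Suc k)" "u < u'" "x (Suc k) \<inter> {u<..<u'} = {}" "u' \<notin> x k"
  shows "\<exists>i>k. u' - u = gap (Suc k) i + int (past_code (window i) (x k) u)"
proof -
  \<comment> \<open>The approximating tower is chosen before the scale \<open>i\<close> is known;
    \<open>i \<le> u' - u\<close> makes this window long enough for whichever code occurs.\<close>
  define l where "l = window (nat (u' - u))"
  obtain S where S: "\<And>j t. j \<le> Suc k \<Longrightarrow> u - int l \<le> t \<Longrightarrow> t \<le> u' \<Longrightarrow> t \<in> x j \<longleftrightarrow> t \<in> tower S j"
    using tower_approx[OF assms(1), of "Suc k" "u - int l" u'] by blast
  have "\<exists>i>k. u' - u = gap (Suc k) i + int (past_code (window i) (tower S k) u)"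
  proof (rule refine_gap_code)
    show "u \<in> refine k (tower S k)" "u' \<in> refine k (tower S k)" "u' \<notin> tower S k"
      using assms S[of "Suc k" u] S[of "Suc k" u'] S[of k u'] by auto
    show "refine k (tower S k) \<inter> {u<..<u'} = {}"
    proof (rule ccontr)
      assume "refine k (tower S k) \<inter> {u<..<u'} \<noteq> {}"
      then obtain t where "t \<in> tower S (Suc k)" "u < t" "t < u'" by auto
      then have "t \<in> x (Suc k)" using S[of "Suc k" t] by simp
      then show False using assms(5) \<open>u < t\<close> \<open>t < u'\<close> by auto
    qed
  qed (rule assms)
  then obtain i where i: "k < i" "u' - u = gap (Suc k) i + int (past_code (window i) (tower S k) u)"
    by blast
  have "int i \<le> u' - u"
    using i(2) magnitude_le_gap[of i "Suc k"] less_magnitude[of i] by linarith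
  then have "window i \<le> l" unfolding l_def by (intro window_mono) simp
  then have "past_code (window i) (tower S k) u = past_code (window i) (x k) u"
    using S[of k] assms(4) by (intro past_code_cong) auto
  then show ?thesis using i by auto
qed

lemma closure_coded_gap:
  assumes "x \<in> tower_closure" "s \<in> x k"
  shows "\<exists>i u u'. k < i \<and> u \<in> x (Suc k) \<and> u' \<in> x (Suc k) \<and> x (Suc k) \<inter> {u<..<u'} = {} \<and> u' \<notin> x k \<and>
           u' - u = gap (Suc k) i + int (past_code (window i) (x k) u) \<and> n \<le> u \<and> u \<le> s + int (window i)"
proof -
  \<comment> \<open>With this choice \<open>magnitude (i - 1)\<close> exceeds \<open>n - s\<close>,
    which pushes \<open>u\<close> beyond \<open>n\<close>.\<close>
  define i where "i = k + 2 + nat (n - s)"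
  have ki: "Suc k < i" by (simp add: i_def)
  obtain j where j: "j = i \<or> j = Suc i" "settles k (x k) s j"
    using closure_sparse_row[OF assms(1), of k] assms(2) Suc_lessD[OF ki] unfolding sparse_row_def by blast
  \<comment> \<open>The window coded at \<open>u \<ge> s\<close> may reach this far to the
    left.\<close>
  define a where "a = s - int (window j)"
  define b where "b = s + run k j + gap k j"
  obtain S where S: "\<And>l t. l \<le> Suc k \<Longrightarrow> a \<le> t \<Longrightarrow> t \<le> b \<Longrightarrow> t \<in> x l \<longleftrightarrow> t \<in> tower S l"
    using tower_approx[OF assms(1), of "Suc k" a b] by blast
  have kj: "Suc k < j" using j ki by auto
  have "settles k (tower S k) s j"
    using j(2) by (rule settles_cong) (use S in \<open>auto simp: a_def b_def\<close>)
  then obtain u u' where u: "u \<in> refine k (tower S k)" "u' \<in> refine k (tower S k)"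
      "refine k (tower S k) \<inter> {u<..<u'} = {}" "u' \<notin> tower S k"
      "u' - u = gap (Suc k) j + int (past_code (window j) (tower S k) u)"
      "s + int (magnitude (j - 1)) \<le> u" "u \<le> s + int (window j)" "u' \<le> b"
    using settles_imp_coded_gap[OF _ kj] unfolding b_def by blast
  have su: "s \<le> u" "u < u'" using u(5,6) gap_pos[of "Suc k" j] by linarith+
  then have in_ab: "a \<le> t \<and> t \<le> b" if "u - int (window j) \<le> t" "t \<le> u'" for t
    using that u(8) by (auto simp: a_def)
  have "u \<in> x (Suc k)" "u' \<in> x (Suc k)" "u' \<notin> x k"
    using u S[of "Suc k" u] S[of "Suc k" u'] S[of k u'] in_ab[of u] in_ab[of u'] su by auto
  moreover have "x (Suc k) \<inter> {u<..<u'} = {}"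
  proof (rule ccontr)
    assume "x (Suc k) \<inter> {u<..<u'} \<noteq> {}"
    then obtain t where "t \<in> x (Suc k)" "u < t" "t < u'" by auto
    then have "t \<in> tower S (Suc k)" using S[of "Suc k" t] in_ab[of t] by simp
    then show False using u(3) \<open>u < t\<close> \<open>t < u'\<close> by auto
  qed
  moreover have "past_code (window j) (tower S k) u = past_code (window j) (x k) u"
    using S[of k] in_ab su by (intro past_code_cong) auto
  moreover have "n \<le> u"
  proof -
    have "nat (n - s) \<le> j - 1" using j(1) by (auto simp: i_def)
    then have "int (nat (n - s)) \<le> int (magnitude (j - 1))" using less_magnitude[of "j - 1"] by linarith
    then show ?thesis using u(6) by linarith
  qed
  ultimately show ?thesis using u(5,7) kj by (intro exI[of _ j] exI[of _ u] exI[of _ u']) auto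
qed

text \<open>Beyond both thresholds of agreement, row \<open>Suc k\<close> of \<open>x\<close> has a
  coded gap whose window reaches back to \<open>s\<close>. In \<open>y\<close> the same gap also
  ends in a new point, so its length carries a code of row \<open>k\<close> of \<open>y\<close>.
  Equal lengths give equal codes, and decoding compares the two rows at \<open>s\<close>, although
  \<open>s\<close> may lie left of the thresholds.\<close>

lemma eventually_agree_imp_subset:
  assumes x: "x \<in> tower_closure" and y: "y \<in> tower_closure"
    and ev: "\<And>k. \<exists>n. \<forall>t\<ge>n. t \<in> x k \<longleftrightarrow> t \<in> y k"
  shows "x k \<subseteq> y k"
proof
  fix s assume s: "s \<in> x k"
  obtain n1 where n1: "\<And>t. t \<ge> n1 \<Longrightarrow> t \<in> x k \<longleftrightarrow> t \<in> y k" using ev[of k] by blast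
  obtain n2 where n2: "\<And>t. t \<ge> n2 \<Longrightarrow> t \<in> x (Suc k) \<longleftrightarrow> t \<in> y (Suc k)" using ev[of "Suc k"] by blast
  define n where "n = max s (max n1 n2)"
  obtain i u u' where u: "k < i" "u \<in> x (Suc k)" "u' \<in> x (Suc k)" "x (Suc k) \<inter> {u<..<u'} = {}" "u' \<notin> x k"
      "u' - u = gap (Suc k) i + int (past_code (window i) (x k) u)" "n \<le> u" "u \<le> s + int (window i)"
    using closure_coded_gap[OF x s, of n] by blast
  have lt: "u < u'" using u(6) gap_pos[of "Suc k" i] by linarith
  have n: "s \<le> u" "n1 \<le> u" "n2 \<le> u" using u(7) by (auto simp: n_def)
  have "y (Suc k) \<inter> {u<..<u'} = {}"
  proof (rule ccontr)
    assume "y (Suc k) \<inter> {u<..<u'} \<noteq> {}"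
    then obtain t where t: "t \<in> y (Suc k)" "u < t" "t < u'" by auto
    then have "t \<in> x (Suc k)" using n2[of t] n by simp
    then show False using u(4) t by auto
  qed
  moreover have "u \<in> y (Suc k)" "u' \<in> y (Suc k)" "u' \<notin> y k"
    using u n lt n2[of u] n2[of u'] n1[of u'] by auto
  ultimately obtain j where j: "k < j" "u' - u = gap (Suc k) j + int (past_code (window j) (y k) u)"
    using closure_gap_code[OF y] lt by blast
  have "i = j \<and> past_code (window i) (x k) u = past_code (window i) (y k) u"
    by (rule gap_code_inject[of "Suc k"]) (use u(1,6) j in auto)
  moreover have "nat (u - s) \<le> window i" using u(8) n by auto
  ultimately have "u - int (nat (u - s)) \<in> x k \<longleftrightarrow> u - int (nat (u - s)) \<in> y k"
    using past_code_inject[of "window i" "x k" u "y k" u "nat (u - s)"] by blast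
  then show "s \<in> y k" using s n by simp
qed

lemma eventually_agree_imp_eq:
  assumes "x \<in> tower_closure" "y \<in> tower_closure" "\<And>k. \<exists>n. \<forall>t\<ge>n. t \<in> x k \<longleftrightarrow> t \<in> y k"
  shows "x = y"
proof (intro ext subset_antisym)
  fix k
  show "x k \<subseteq> y k" by (rule eventually_agree_imp_subset[OF assms])
  have "\<And>k. \<exists>n. \<forall>t\<ge>n. t \<in> y k \<longleftrightarrow> t \<in> x k" using assms(3) by metis
  then show "y k \<subseteq> x k" by (rule eventually_agree_imp_subset[OF assms(2,1)])
qed

section \<open>Common vacancies and proximality\<close>

lemma sparse_row_vacant:
  assumes "sparse_row k V" "k < i"
  shows "\<exists>p\<ge>t. p \<le> t + gap k i + run k (Suc i) \<and> vacant V p (gap k i)"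
proof (cases "vacant V t (gap k i)")
  case True
  then show ?thesis using gap_pos[of k i] run_nonneg[of k "Suc i"] by (intro exI[of _ t]) auto
next
  case False
  then obtain s where s: "s \<in> V" "t < s" "s < t + gap k i" by (auto simp: vacant_def)
  then obtain j where j: "j = i \<or> j = Suc i" "settles k V s j"
    using assms by (auto simp: sparse_row_def)
  then obtain r where r: "s \<le> r" "r \<le> s + run k j" "vacant V r (gap k j)" by (auto simp: settles_def)
  have "i \<le> j" "j \<le> Suc i" using j(1) by auto
  then have "run k j \<le> run k (Suc i)" "vacant V r (gap k i)"
    using run_mono vacant_gap_mono[OF r(3)] by auto
  then show ?thesis using r s by (intro exI[of _ r]) auto
qed

text \<open>A vacant stretch of \<open>y\<close> two scales larger contains the whole range in which
  \<open>x\<close> must start a vacant stretch of scale \<open>i\<close>, and that stretch as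
  well.\<close>

lemma common_vacancy:
  assumes x: "x \<in> tower_closure" and y: "y \<in> tower_closure"
  shows "\<exists>n\<ge>n0. agree m (shift n x) (shift n y)"
proof -
  define i where "i = Suc m + 2 * Suc m"
  have mi: "m < i" by (simp add: i_def)
  obtain p where p: "p \<ge> n0" "vacant (y m) p (gap m (i + 2))"
    using sparse_row_vacant[OF closure_sparse_row[OF y], of m "i + 2" n0] mi by auto
  obtain q where q: "q \<ge> p" "q \<le> p + gap m i + run m (Suc i)" "vacant (x m) q (gap m i)"
    using sparse_row_vacant[OF closure_sparse_row[OF x], of m i p] mi by auto
  have "2 * gap m i + run m (Suc i) \<le> gap m (i + 2)"
  proof -
    have "2 * gap m i \<le> 2 * int (unit_run (Suc i))" using gap_le_unit_run[of m i] by simp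
    then have "2 * gap m i + run m (Suc i) \<le> int ((m + 3) * unit_run (Suc i))"
      by (simp add: run_def algebra_simps)
    also have "\<dots> \<le> int ((Suc i + 2) * unit_run (Suc i))"
      unfolding of_nat_le_iff using mi by (intro mult_le_mono1) simp
    also have "\<dots> \<le> int (magnitude (Suc i))" using magnitude_large[of "Suc i"] by linarith
    also have "\<dots> \<le> int (magnitude (i + 2))" using magnitude_mono[of "Suc i" "i + 2"] by simp
    also have "\<dots> \<le> gap m (i + 2)" by (rule magnitude_le_gap)
    finally show ?thesis .
  qed
  then have "vacant (y m) q (gap m i)" using p(2) q by (auto simp: vacant_def)
  \<comment> \<open>An open interval of this length holds \<open>2 * m + 1\<close> integers, centred
    at \<open>q + m + 1\<close>; being vacant in row \<open>m\<close>, it is vacant in all earlier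
    rows.\<close>
  moreover have "int (2 * m + 2) \<le> gap m i"
    using less_magnitude[of i] magnitude_le_gap[of i m] by (simp add: i_def)
  ultimately have vac: "t \<notin> x m \<and> t \<notin> y m" if "q < t" "t < q + int (2 * m + 2)" for t
    using q(3) that by (auto simp: vacant_def)
  have sub: "x k \<subseteq> x m" "y k \<subseteq> y m" if "k \<le> m" for k
    using closure_mono[OF x that] closure_mono[OF y that] by auto
  have "agree m (shift (q + int m + 1) x) (shift (q + int m + 1) y)"
    unfolding agree_def shift_def in_translate
  proof (intro allI impI ballI)
    fix k t assume k: "k \<le> m" and t: "t \<in> {- int m..int m}"
    have "t + (q + int m + 1) \<notin> x m \<and> t + (q + int m + 1) \<notin> y m"
      using t by (intro vac) auto
    then show "t + (q + int m + 1) \<in> x k \<longleftrightarrow> t + (q + int m + 1) \<in> y k" using sub[OF k] by blast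
  qed
  then show ?thesis using p q by (intro exI[of _ "q + int m + 1"]) auto
qed

section \<open>Mixing in the closure\<close>

lemma alike_Min:
  assumes "finite S" "S \<noteq> {}" "\<And>t. \<bar>t\<bar> \<le> L \<Longrightarrow> t \<in> S \<longleftrightarrow> t \<in> W"
  shows "alike (Min S) L S W"
proof -
  have "t \<notin> S" if "t < Min S" for t
    using that Min_le[OF assms(1)] by (metis linorder_not_le)
  then have "S \<inter> {-L..<Min S} = {}" by auto
  then show ?thesis using assms Min_in by (auto simp: alike_def abs_le_iff)
qed

lemma alike_agree:
  assumes "\<forall>k\<le>m. alike c (int m) (tower S k) (tower S' k)"
  shows "agree m (tower S) (tower S')"
  using assms by (auto simp: agree_def alike_def)

lemma closure_mixing:
  assumes x: "x \<in> tower_closure" and y: "y \<in> tower_closure"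
  shows "\<exists>N. \<forall>n\<ge>N. \<exists>z\<in>tower_closure. agree m x z \<and> agree m y (shift n z)"
proof -
  obtain S where S: "seed S" "agree m x (tower S)" using x by (auto simp: tower_closure_def)
  obtain S' where S': "seed S'" "agree m y (tower S')" using y by (auto simp: tower_closure_def)
  obtain n0 where n0: "\<And>n. n \<ge> n0 \<Longrightarrow> seed (S \<union> translate (- n) S')" using seed_glue S S' by blast
  have fin: "finite S" "finite S'" "S \<noteq> {}" "S' \<noteq> {}" using S S' by (auto simp: seed_def)
  obtain L where L: "\<And>V W. alike (Min S) L V W \<Longrightarrow> \<forall>k\<le>m. alike (Min S) (int m) (tower V k) (tower W k)"
    using tower_local[of "int m" "Min S" m] by auto
  obtain L' where L': "\<And>V W. alike (Min S') L' V W \<Longrightarrow> \<forall>k\<le>m. alike (Min S') (int m) (tower V k) (tower W k)"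
    using tower_local[of "int m" "Min S'" m] by auto
  \<comment> \<open>These bounds keep the moved copy of \<open>S'\<close> to the right of the window
    of radius \<open>L\<close> and, seen from position \<open>n\<close>, keep \<open>S\<close> to
    the left of the window of radius \<open>L'\<close>.\<close>
  define N where "N = max n0 (max (L - Min S' + 1) (L' + Max S + 1))"
  have "\<exists>z\<in>tower_closure. agree m x z \<and> agree m y (shift n z)" if n: "n \<ge> N" for n
  proof -
    let ?V = "S \<union> translate (- n) S'"
    have nb: "n0 \<le> n" "L - Min S' < n" "L' + Max S < n" using n by (auto simp: N_def)
    have right: "t > L" if "t - n \<in> S'" for t
      using Min_le[OF fin(2) that] nb(2) by linarith
    have left: "t < - L'" if "t + n \<in> S" for t
      using Max_ge[OF fin(1) that] nb(3) by linarith
    have "alike (Min S) L S ?V"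
    proof (rule alike_Min)
      fix t assume "\<bar>t\<bar> \<le> L"
      then have "t - n \<notin> S'" using right[of t] by linarith
      then show "t \<in> S \<longleftrightarrow> t \<in> ?V" by simp
    qed (use fin in auto)
    then have "agree m (tower S) (tower ?V)" using L alike_agree by blast
    moreover have "alike (Min S') L' S' (translate n ?V)"
    proof (rule alike_Min)
      fix t assume "\<bar>t\<bar> \<le> L'"
      then have "t + n \<notin> S" using left[of t] by linarith
      then show "t \<in> S' \<longleftrightarrow> t \<in> translate n ?V" by simp
    qed (use fin in auto)
    then have "agree m (tower S') (shift n (tower ?V))" using L' alike_agree by (metis shift_tower)
    moreover have "tower ?V \<in> tower_closure" using n0[OF nb(1)] by (rule tower_in_closure)
    ultimately show ?thesis using S(2) S'(2) agree_trans by blast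
  qed
  then show ?thesis by blast
qed

section \<open>Embedding into the real line\<close>

text \<open>Base 4 with digits 0 and 1 leaves gaps between the values of different initial segments,
  so close values share initial digits; with base 2 this would fail.\<close>

definition quaternary :: "(nat \<Rightarrow> bool) \<Rightarrow> real" where
  "quaternary b = (\<Sum>n. of_bool (b n) * (1/4) ^ n)"

lemma summable_quaternary: "summable (\<lambda>n. of_bool (b n) * (1/4::real) ^ n)"
  by (rule summable_comparison_test'[of "\<lambda>n. (1/4) ^ n" 0]) auto

lemma quaternary_nonneg: "0 \<le> quaternary b"
  unfolding quaternary_def by (rule suminf_nonneg[OF summable_quaternary]) simp

lemma quaternary_le: "quaternary b \<le> 4/3"
proof -
  have "quaternary b \<le> (\<Sum>n. (1/4::real) ^ n)"
    unfolding quaternary_def by (rule suminf_le[OF _ summable_quaternary]) auto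
  then show ?thesis by (simp add: suminf_geometric)
qed

lemma quaternary_split:
  "quaternary b = (\<Sum>n<N. of_bool (b n) * (1/4) ^ n) + (1/4) ^ N * quaternary (\<lambda>n. b (n + N))"
proof -
  have "(\<Sum>n. of_bool (b (n + N)) * (1/4::real) ^ (n + N)) = (1/4) ^ N * quaternary (\<lambda>n. b (n + N))"
    unfolding quaternary_def
    by (subst suminf_mult[OF summable_quaternary, symmetric]) (simp add: power_add mult_ac)
  then show ?thesis
    unfolding quaternary_def[of b]
    by (subst suminf_split_initial_segment[OF summable_quaternary, of _ N]) simp
qed

lemma quaternary_close:
  assumes "\<And>n. n < N \<Longrightarrow> b n = c n"
  shows "\<bar>quaternary b - quaternary c\<bar> \<le> 2 * (1/4) ^ N"
proof -
  have "quaternary b - quaternary c = (1/4) ^ N * (quaternary (\<lambda>n. b (n + N)) - quaternary (\<lambda>n. c (n + N)))"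
    using quaternary_split[of b N] quaternary_split[of c N] assms by (simp add: algebra_simps)
  moreover have "\<bar>quaternary (\<lambda>n. b (n + N)) - quaternary (\<lambda>n. c (n + N))\<bar> \<le> 2"
    using quaternary_nonneg[of "\<lambda>n. b (n + N)"] quaternary_nonneg[of "\<lambda>n. c (n + N)"]
      quaternary_le[of "\<lambda>n. b (n + N)"] quaternary_le[of "\<lambda>n. c (n + N)"] by linarith
  ultimately show ?thesis by (simp add: abs_mult)
qed

text \<open>Digit \<open>j\<close> contributes \<open>(1/4) ^ j\<close>, and the later digits can
  cancel at most a third of that.\<close>

lemma quaternary_apart:
  assumes "\<And>n. n < j \<Longrightarrow> b n = c n" "b j" "\<not> c j"
  shows "quaternary b - quaternary c \<ge> 1/2 * (1/4) ^ j"
proof -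
  let ?b = "\<lambda>n. b (n + Suc j)" and ?c = "\<lambda>n. c (n + Suc j)"
  have "quaternary b - quaternary c = (1/4) ^ j + (1/4) ^ Suc j * (quaternary ?b - quaternary ?c)"
    using quaternary_split[of b "Suc j"] quaternary_split[of c "Suc j"] assms
    by (simp add: algebra_simps)
  moreover have "quaternary ?b - quaternary ?c \<ge> - (4/3)"
    using quaternary_nonneg[of ?b] quaternary_le[of ?c] by linarith
  then have "(1/4::real) ^ Suc j * (quaternary ?b - quaternary ?c) \<ge> (1/4) ^ Suc j * - (4/3)"
    by (intro mult_left_mono) auto
  ultimately have "quaternary b - quaternary c \<ge> (2/3) * (1/4) ^ j" by simp
  moreover have "(1/4::real) ^ j \<ge> 0" by simp
  ultimately show ?thesis by linarith
qed

lemma quaternary_inject: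
  assumes "\<bar>quaternary b - quaternary c\<bar> < 1/2 * (1/4) ^ N" "n \<le> N"
  shows "b n = c n"
proof (rule ccontr)
  assume "b n \<noteq> c n"
  define j where "j = (LEAST n. b n \<noteq> c n)"
  have j: "b j \<noteq> c j" "j \<le> n" "\<And>i. i < j \<Longrightarrow> b i = c i"
    unfolding j_def using \<open>b n \<noteq> c n\<close> LeastI[of "\<lambda>n. b n \<noteq> c n"] Least_le[of "\<lambda>n. b n \<noteq> c n"]
      not_less_Least[of _ "\<lambda>n. b n \<noteq> c n"] by blast+
  have "(1/4::real) ^ N \<le> (1/4) ^ j" using j(2) assms(2) by (intro power_decreasing) auto
  moreover have "\<bar>quaternary b - quaternary c\<bar> \<ge> 1/2 * (1/4) ^ j"
  proof (cases "b j")
    case True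
    then have "1/2 * (1/4) ^ j \<le> quaternary b - quaternary c" using j by (intro quaternary_apart) auto
    then show ?thesis by linarith
  next
    case False
    then have "1/2 * (1/4) ^ j \<le> quaternary c - quaternary b" using j by (intro quaternary_apart) auto
    then show ?thesis by linarith
  qed
  ultimately show False using assms(1) by linarith
qed

section \<open>Coding sequences of rows by real numbers\<close>

definition encode :: "(nat \<Rightarrow> int set) \<Rightarrow> real" where
  "encode x = quaternary (\<lambda>n. snd (from_nat n :: nat \<times> int) \<in> x (fst (from_nat n :: nat \<times> int)))"

lemma encode_close_imp_agree: "\<exists>e>0. \<forall>x y. \<bar>encode x - encode y\<bar> < e \<longrightarrow> agree m x y"
proof -
  let ?A = "{..m} \<times> {- int m..int m}"
  define N where "N = Max (to_nat ` ?A)"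
  have "agree m x y" if "\<bar>encode x - encode y\<bar> < 1/2 * (1/4) ^ N" for x y
    unfolding agree_def
  proof (intro allI impI ballI)
    fix k t assume "k \<le> m" "t \<in> {- int m..int m}"
    then have "to_nat (k, t) \<le> N" unfolding N_def by (intro Max_ge) auto
    then show "t \<in> x k \<longleftrightarrow> t \<in> y k"
      using quaternary_inject[OF that[unfolded encode_def], of "to_nat (k, t)"] by simp
  qed
  then show ?thesis by (intro exI[of _ "1/2 * (1/4) ^ N"]) auto
qed

lemma agree_imp_encode_close:
  assumes "e > 0"
  shows "\<exists>m. \<forall>x y. agree m x y \<longrightarrow> \<bar>encode x - encode y\<bar> < e"
proof -
  obtain N where N: "(1/4::real) ^ N < e / 2"
    using real_arch_pow_inv[of "e / 2" "1/4"] assms by auto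
  \<comment> \<open>A crude bound: the sum dominates the row index and the absolute position of each
    of the first \<open>N\<close> coordinates.\<close>
  define m where "m = (\<Sum>n<N. fst (from_nat n :: nat \<times> int) + nat \<bar>snd (from_nat n :: nat \<times> int)\<bar>)"
  have "\<bar>encode x - encode y\<bar> < e" if "agree m x y" for x y
  proof -
    have "\<bar>encode x - encode y\<bar> \<le> 2 * (1/4) ^ N"
      unfolding encode_def
    proof (rule quaternary_close)
      fix n assume "n < N"
      then have "fst (from_nat n :: nat \<times> int) + nat \<bar>snd (from_nat n :: nat \<times> int)\<bar> \<le> m"
        unfolding m_def by (intro member_le_sum) auto
      then show "(snd (from_nat n :: nat \<times> int) \<in> x (fst (from_nat n :: nat \<times> int)))
          = (snd (from_nat n :: nat \<times> int) \<in> y (fst (from_nat n :: nat \<times> int)))"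
        by (intro agreeD[OF that]) auto
    qed
    then show ?thesis using N by simp
  qed
  then show ?thesis by blast
qed

lemma inj_encode: "inj encode"
proof (rule injI)
  fix x y assume eq: "encode x = encode y"
  show "x = y"
  proof (rule agree_all_eq)
    fix m show "agree m x y" using encode_close_imp_agree[of m] eq by auto
  qed
qed

section \<open>The shift on the image, and the image as a Cantor set\<close>

definition shift_map :: "int \<Rightarrow> real \<Rightarrow> real" where
  "shift_map n r = encode (shift n (inv encode r))"

lemma shift_map_encode [simp]: "shift_map n (encode x) = encode (shift n x)"
  by (simp add: shift_map_def inv_f_f[OF inj_encode])

lemma shift_map_funpow: "(shift_map 1 ^^ n) (encode x) = encode (shift (int n) x)"
  by (induction n) (auto simp: algebra_simps)

abbreviation cantor_image :: "real set" where
  "cantor_image \<equiv> encode ` tower_closure"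

lemma compact_cantor_image: "compact cantor_image"
proof -
  have "bounded cantor_image"
    unfolding bounded_iff encode_def
    by (intro exI[of _ "4/3"]) (use quaternary_nonneg quaternary_le in auto)
  moreover have "closed cantor_image"
    unfolding closed_sequential_limits
  proof (intro allI impI)
    fix r l assume "(\<forall>n. r n \<in> cantor_image) \<and> r \<longlonglongrightarrow> l"
    then have r: "\<And>n. r n \<in> cantor_image" and lim: "r \<longlonglongrightarrow> l" by auto
    have "\<exists>x. x \<in> tower_closure \<and> r n = encode x" for n using r[of n] by blast
    then obtain f where f: "\<And>n. f n \<in> tower_closure" "\<And>n. r n = encode (f n)" by metis
    have stab: "\<exists>J. \<forall>i\<ge>J. \<forall>j\<ge>J. agree m (f i) (f j)" for m
    proof -
      obtain e where e: "e > 0" "\<And>x y. \<bar>encode x - encode y\<bar> < e \<Longrightarrow> agree m x y"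
        using encode_close_imp_agree by blast
      have "Cauchy r" using lim by (rule LIMSEQ_imp_Cauchy)
      then obtain J where "\<And>i j. i \<ge> J \<Longrightarrow> j \<ge> J \<Longrightarrow> \<bar>r i - r j\<bar> < e"
        using e(1) unfolding Cauchy_def dist_real_def by metis
      then show ?thesis using e(2) unfolding f(2) by blast
    qed
    \<comment> \<open>By \<open>stab\<close> each membership is eventually constant along
      \<open>f\<close>, so this set is the coordinatewise limit.\<close>
    define x where "x k = {t. eventually (\<lambda>j. t \<in> f j k) sequentially}" for k
    have ev: "\<exists>J. \<forall>j\<ge>J. agree m x (f j)" for m
    proof -
      obtain J where J: "\<And>i j. i \<ge> J \<Longrightarrow> j \<ge> J \<Longrightarrow> agree m (f i) (f j)" using stab by blast
      have "agree m x (f j)" if "j \<ge> J" for j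
        unfolding agree_def
      proof (intro allI impI ballI)
        fix k t assume kt: "k \<le> m" "t \<in> {- int m..int m}"
        have same: "t \<in> f i k \<longleftrightarrow> t \<in> f j k" if "i \<ge> J" for i
          using J[OF that \<open>j \<ge> J\<close>] kt by (auto simp: agree_def)
        show "t \<in> x k \<longleftrightarrow> t \<in> f j k"
        proof
          assume "t \<in> x k"
          then obtain K where "\<And>i. i \<ge> K \<Longrightarrow> t \<in> f i k" by (auto simp: x_def eventually_sequentially)
          then show "t \<in> f j k" using same[of "max J K"] by simp
        next
          assume "t \<in> f j k"
          then show "t \<in> x k" using same by (auto simp: x_def eventually_sequentially)
        qed
      qed
      then show ?thesis by blast
    qed
    have x: "x \<in> tower_closure"
      by (rule tower_closure_closed) (use ev f(1) in blast)
    have "r \<longlonglongrightarrow> encode x"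
    proof (rule LIMSEQ_I)
      fix e :: real assume "e > 0"
      then obtain m where m: "\<And>x y. agree m x y \<Longrightarrow> \<bar>encode x - encode y\<bar> < e"
        using agree_imp_encode_close by blast
      obtain J where J: "\<And>j. j \<ge> J \<Longrightarrow> agree m x (f j)" using ev by blast
      show "\<exists>J. \<forall>j\<ge>J. norm (r j - encode x) < e"
        using m[OF agree_sym[OF J]] f(2) by (intro exI[of _ J]) auto
    qed
    then have "l = encode x" using lim LIMSEQ_unique by blast
    then show "l \<in> cantor_image" using x by blast
  qed
  ultimately show ?thesis using compact_eq_bounded_closed by blast
qed

text \<open>The truth value \<open>P\<close> treats a cylinder and its complement at once; together
  they make the cylinder clopen.\<close>

lemma clopen_cylinder:
  "openin (top_of_set cantor_image) (encode ` {y \<in> tower_closure. agree m x y \<longleftrightarrow> P})"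
proof -
  obtain e where e: "e > 0" "\<And>x y. \<bar>encode x - encode y\<bar> < e \<Longrightarrow> agree m x y"
    using encode_close_imp_agree by blast
  show ?thesis
    unfolding openin_euclidean_subtopology_iff
  proof (intro conjI ballI)
    fix r assume "r \<in> encode ` {y \<in> tower_closure. agree m x y \<longleftrightarrow> P}"
    then obtain y where y: "y \<in> tower_closure" "agree m x y \<longleftrightarrow> P" "r = encode y" by auto
    have "encode z \<in> encode ` {y \<in> tower_closure. agree m x y \<longleftrightarrow> P}"
      if "z \<in> tower_closure" "dist (encode z) r < e" for z
    proof -
      have "agree m z y" using e(2) that(2) y(3) by (simp add: dist_real_def)
      then have "agree m x z \<longleftrightarrow> P" using y(2) agree_trans agree_sym by blast
      then show ?thesis using that(1) by blast
    qed
    then show "\<exists>e>0. \<forall>z\<in>cantor_image. dist z r < e \<longrightarrow> z \<in> encode ` {y \<in> tower_closure. agree m x y \<longleftrightarrow> P}"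
      using e(1) by blast
  qed auto
qed

lemma cylinder_subset:
  assumes "openin (top_of_set cantor_image) U" "encode x \<in> U"
  shows "\<exists>m. \<forall>y\<in>tower_closure. agree m x y \<longrightarrow> encode y \<in> U"
proof -
  obtain e where e: "e > 0" "\<And>z. z \<in> cantor_image \<Longrightarrow> dist z (encode x) < e \<Longrightarrow> z \<in> U"
    using assms unfolding openin_euclidean_subtopology_iff by blast
  obtain m where m: "\<And>x y. agree m x y \<Longrightarrow> \<bar>encode x - encode y\<bar> < e"
    using agree_imp_encode_close[OF e(1)] by blast
  have "encode y \<in> U" if "y \<in> tower_closure" "agree m x y" for y
    using that m[OF agree_sym[OF that(2)]] by (intro e(2)) (auto simp: dist_real_def)
  then show ?thesis by blast
qed

lemma dim_cantor_image: "top_of_set cantor_image dim_le 0"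
  unfolding dimension_le_0_neighbourhood_base_of_clopen neighbourhood_base_of
proof (intro allI impI)
  fix W r assume "openin (top_of_set cantor_image) W \<and> r \<in> W"
  then have W: "openin (top_of_set cantor_image) W" "r \<in> W" by auto
  then obtain x where x: "x \<in> tower_closure" "r = encode x" 
    using openin_imp_subset[OF W(1)] by blast
  obtain m where m: "\<And>y. y \<in> tower_closure \<Longrightarrow> agree m x y \<Longrightarrow> encode y \<in> W"
    using cylinder_subset[OF W(1), of x] W(2) x(2) by blast
  define C where "C = encode ` {y \<in> tower_closure. agree m x y}"
  have "openin (top_of_set cantor_image) C" using clopen_cylinder[of m x True] by (simp add: C_def)
  moreover have "cantor_image - C = encode ` {y \<in> tower_closure. \<not> agree m x y}"
    unfolding C_def using inj_encode by (auto simp: inj_eq)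
  then have "closedin (top_of_set cantor_image) C"
    using clopen_cylinder[of m x False] by (auto simp: closedin_def C_def)
  moreover have "r \<in> C" "C \<subseteq> W" using x m by (auto simp: C_def agree_def)
  ultimately show "\<exists>U V. openin (top_of_set cantor_image) U \<and>
      (closedin (top_of_set cantor_image) V \<and> openin (top_of_set cantor_image) V) \<and> r \<in> U \<and> U \<subseteq> V \<and> V \<subseteq> W"
    by blast
qed

text \<open>Mixing excludes isolated points. If \<open>x\<close> were alone in a cylinder, then for
  large \<open>n\<close> the single point \<open>shift n x\<close> would be near the towers over
  both \<open>{0}\<close> and \<open>{1}\<close>, which differ at position 0.\<close>

lemma islimpt_cantor_image:
  assumes "x \<in> tower_closure"
  shows "encode x islimpt cantor_image"
  unfolding islimpt_approachable
proof (intro allI impI)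
  fix e :: real assume "e > 0"
  then obtain m where m: "\<And>x y. agree m x y \<Longrightarrow> \<bar>encode x - encode y\<bar> < e"
    using agree_imp_encode_close by blast
  have "\<exists>z\<in>tower_closure. agree m x z \<and> z \<noteq> x"
  proof (rule ccontr)
    assume "\<not> ?thesis"
    then have only: "\<And>z. z \<in> tower_closure \<Longrightarrow> agree m x z \<Longrightarrow> z = x" by blast
    have "seed (translate (- 1) {0})" by (rule seed_translate[OF seed_singleton])
    then have mem: "tower {0} \<in> tower_closure" "tower (translate (- 1) {0}) \<in> tower_closure"
      using seed_singleton tower_in_closure by auto
    obtain N1 where N1: "\<And>n. n \<ge> N1 \<Longrightarrow> \<exists>z\<in>tower_closure. agree m x z \<and> agree m (tower {0}) (shift n z)"
      using closure_mixing[OF assms mem(1)] by blast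
    obtain N2 where N2: "\<And>n. n \<ge> N2 \<Longrightarrow> \<exists>z\<in>tower_closure. agree m x z \<and> agree m (tower (translate (- 1) {0})) (shift n z)"
      using closure_mixing[OF assms mem(2)] by blast
    define n where "n = max N1 N2"
    have "agree m (tower {0}) (shift n x)" "agree m (tower (translate (- 1) {0})) (shift n x)"
      using N1[of n] N2[of n] only unfolding n_def by (metis max.cobounded1, metis max.cobounded2)
    then have "agree m (tower {0}) (tower (translate (- 1) {0}))" using agree_sym agree_trans by blast
    then have "0 \<in> tower {0} 0 \<longleftrightarrow> 0 \<in> tower (translate (- 1) {0}) 0" by (rule agreeD) auto
    then show False by simp
  qed
  then obtain z where z: "z \<in> tower_closure" "agree m x z" "z \<noteq> x" by blast
  then show "\<exists>x'\<in>cantor_image. x' \<noteq> encode x \<and> dist x' (encode x) < e"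
    using m[OF agree_sym[OF z(2)]] inj_encode
    by (intro bexI[of _ "encode z"]) (auto simp: dist_real_def inj_eq)
qed

lemma cantor_set_cantor_image: "cantor_set cantor_image"
  using compact_cantor_image dim_cantor_image islimpt_cantor_image tower_in_closure[OF seed_singleton]
  by (auto simp: cantor_set_def)

lemma continuous_on_shift_map: "continuous_on cantor_image (shift_map n)"
  unfolding continuous_on_iff
proof (intro ballI allI impI)
  fix r e :: real assume "r \<in> cantor_image" "e > 0"
  then obtain x where x: "r = encode x" by blast
  obtain m where m: "\<And>x y. agree m x y \<Longrightarrow> \<bar>encode x - encode y\<bar> < e"
    using agree_imp_encode_close[OF \<open>e > 0\<close>] by blast
  obtain d where d: "d > 0" "\<And>x y. \<bar>encode x - encode y\<bar> < d \<Longrightarrow> agree (m + nat \<bar>n\<bar>) x y"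
    using encode_close_imp_agree by blast
  have "dist (shift_map n (encode y)) (shift_map n r) < e" if "dist (encode y) r < d" for y
    using m[OF agree_shift[OF d(2)]] that x by (simp add: dist_real_def)
  then show "\<exists>d>0. \<forall>r'\<in>cantor_image. dist r' r < d \<longrightarrow> dist (shift_map n r') (shift_map n r) < e"
    using d(1) by blast
qed

lemma homeomorphism_shift_map: "homeomorphism cantor_image cantor_image (shift_map 1) (shift_map (- 1))"
proof -
  have "shift_map n ` cantor_image \<subseteq> cantor_image" for n
    using shift_in_closure by auto
  then show ?thesis
    by (intro homeomorphismI continuous_on_shift_map) auto
qed

section \<open>Mixing and scrambling of the shift map\<close>

lemma topologically_mixing_shift_map: "topologically_mixing cantor_image (shift_map 1)"
  unfolding topologically_mixing_def
proof (intro allI impI, elim conjE)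
  fix U V
  assume U: "openin (top_of_set cantor_image) U" "U \<noteq> {}" and V: "openin (top_of_set cantor_image) V" "V \<noteq> {}"
  obtain x where x: "x \<in> tower_closure" "encode x \<in> U" using U(2) openin_imp_subset[OF U(1)] by blast
  obtain y where y: "y \<in> tower_closure" "encode y \<in> V" using V(2) openin_imp_subset[OF V(1)] by blast
  obtain m1 where m1: "\<And>z. z \<in> tower_closure \<Longrightarrow> agree m1 x z \<Longrightarrow> encode z \<in> U"
    using cylinder_subset[OF U(1) x(2)] by blast
  obtain m2 where m2: "\<And>z. z \<in> tower_closure \<Longrightarrow> agree m2 y z \<Longrightarrow> encode z \<in> V"
    using cylinder_subset[OF V(1) y(2)] by blast
  obtain N where N: "\<And>n. n \<ge> N \<Longrightarrow> \<exists>z\<in>tower_closure. agree (max m1 m2) x z \<and> agree (max m1 m2) y (shift n z)"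
    using closure_mixing[OF x(1) y(1)] by blast
  have "(shift_map 1 ^^ n) ` U \<inter> V \<noteq> {}" if "n \<ge> nat N" for n
  proof -
    have "int n \<ge> N" using that by simp
    then obtain z where z: "z \<in> tower_closure" "agree (max m1 m2) x z" "agree (max m1 m2) y (shift (int n) z)"
      using N by blast
    have "encode z \<in> U" using m1 z agree_mono[of "max m1 m2" x z m1] by simp
    moreover have "encode (shift (int n) z) \<in> V"
      using m2 z shift_in_closure agree_mono[of "max m1 m2" y _ m2] by simp
    ultimately show ?thesis using shift_map_funpow[of n z] by (metis IntI empty_iff imageI)
  qed
  then show "\<exists>N. \<forall>n\<ge>N. (shift_map 1 ^^ n) ` U \<inter> V \<noteq> {}" by blast
qed

lemma liminf_eq_0:
  fixes f :: "nat \<Rightarrow> real"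
  assumes "\<And>n. f n \<ge> 0" "\<And>e N. e > 0 \<Longrightarrow> \<exists>n\<ge>N. f n < e"
  shows "liminf (\<lambda>n. ereal (f n)) = 0"
proof (rule antisym)
  show "0 \<le> liminf (\<lambda>n. ereal (f n))"
    by (rule Liminf_bounded) (simp add: assms(1))
  show "liminf (\<lambda>n. ereal (f n)) \<le> 0"
  proof (rule ccontr)
    assume "\<not> ?thesis"
    then obtain z where z: "0 < ereal z" "ereal z < liminf (\<lambda>n. ereal (f n))"
      using ereal_dense2[of 0] by (metis not_le)
    then have "eventually (\<lambda>n. ereal z < ereal (f n)) sequentially"
      using less_LiminfD by blast
    then obtain N where "\<And>n. n \<ge> N \<Longrightarrow> z < f n" by (auto simp: eventually_sequentially)
    then show False using assms(2)[of z N] z(1) by fastforce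
  qed
qed

lemma completely_scrambled_shift_map: "completely_scrambled cantor_image (shift_map 1)"
  unfolding completely_scrambled_def li_yorke_pair_def
proof (intro ballI impI conjI)
  fix r s assume "r \<in> cantor_image" "s \<in> cantor_image" "r \<noteq> s"
  then obtain x y where x: "x \<in> tower_closure" "r = encode x" and y: "y \<in> tower_closure" "s = encode y"
    and "x \<noteq> y" by auto
  let ?f = "\<lambda>n. \<bar>encode (shift (int n) x) - encode (shift (int n) y)\<bar>"
  have f: "dist ((shift_map 1 ^^ n) r) ((shift_map 1 ^^ n) s) = ?f n" for n
    by (simp add: x y shift_map_funpow dist_real_def)
  show "proximal (shift_map 1) r s"
    unfolding proximal_def f
  proof (rule liminf_eq_0)
    fix e :: real and N :: nat assume "e > 0"
    then obtain m where m: "\<And>x y. agree m x y \<Longrightarrow> \<bar>encode x - encode y\<bar> < e"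
      using agree_imp_encode_close by blast
    obtain n where n: "n \<ge> int N" "agree m (shift n x) (shift n y)"
      using common_vacancy[OF x(1) y(1)] by blast
    then show "\<exists>n\<ge>N. ?f n < e" using m[OF n(2)] by (intro exI[of _ "nat n"]) auto
  qed simp
  show "\<not> asymptotic (shift_map 1) r s"
  proof
    assume "asymptotic (shift_map 1) r s"
    then have ls: "limsup (\<lambda>n. ereal (?f n)) = 0" unfolding asymptotic_def f .
    have "x = y"
    proof (rule eventually_agree_imp_eq[OF x(1) y(1)])
      fix k
      obtain e where e: "e > 0" "\<And>x y. \<bar>encode x - encode y\<bar> < e \<Longrightarrow> agree k x y"
        using encode_close_imp_agree by blast
      have "limsup (\<lambda>n. ereal (?f n)) < ereal e" using ls e(1) by simp
      then have "eventually (\<lambda>n. ereal (?f n) < ereal e) sequentially" by (rule Limsup_lessD)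
      then obtain N where N: "\<And>n. n \<ge> N \<Longrightarrow> ?f n < e" by (auto simp: eventually_sequentially)
      \<comment> \<open>Closeness at time \<open>t\<close> is used only at the origin of row
        \<open>k\<close>, which for the shifted points is position \<open>t\<close>.\<close>
      have "t \<in> x k \<longleftrightarrow> t \<in> y k" if "t \<ge> int N" for t
        using agreeD[OF e(2)[OF N[of "nat t"]], of k 0] that by (simp add: shift_def)
      then show "\<exists>n. \<forall>t\<ge>n. t \<in> x k \<longleftrightarrow> t \<in> y k" by blast
    qed
    then show False using \<open>x \<noteq> y\<close> by simp
  qed
qed

theorem theorem1p2:
  shows "\<exists>(X::real set) T. cantor_set X \<and> (\<exists>T'. homeomorphism X X T T') \<and>
           topologically_mixing X T \<and> completely_scrambled X T"
  using cantor_set_cantor_image homeomorphism_shift_map topologically_mixing_shift_map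
    completely_scrambled_shift_map by blast

end
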